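(* Let $\underline{A}$ be a 2-category with contravariance. Every object of $\underline{A}$ has a strict opposite if and only if $\underline{A}$, regarded as a $\mathbf{V}$-category, has all copowers by the dual unit $\mathbb{1}^-=(0,1)\in\mathbf{V}$ (that is, the copower $\mathbb{1}^-\odot x$ exists for every object $x$).
   Context: A **2-category with contravariance** $\underline{A}$ consists of a collection of objects; for each pair $x,y$ two categories $\underline{A}^+(x,y)$ and $\underline{A}^-(x,y)$; an object $1_x\in\underline{A}^+(x,x)$ for each $x$; and composition functors $$\underline{A}^+(y,z)\times\underline{A}^+(x,y)\to\underline{A}^+(x,z),\qquad \underline{A}^-(y,z)\times\underline{A}^-(x,y)^{\mathrm{op}}\to\underline{A}^+(x,z),$$ $$\underline{A}^+(y,z)\times\underline{A}^-(x,y)\to\underline{A}^-(x,z),\qquad \underline{A}^-(y,z)\times\underline{A}^+(x,y)^{\mathrm{op}}\to\underline{A}^-(x,z),$$ which are strictly unital and strictly associative for all variances. A **strict opposite** of $x$ is an object $x^\circ$ with $\chi_x\in\underline{A}^-(x,x^\circ)$ such that for all $y$ precomposition with $\chi_x$ induces isomorphisms of categories $\underline{A}^+(x^\circ,y)\xrightarrow{\sim}\underline{A}^-(x,y)$ and $\underline{A}^-(x^\circ,y)\xrightarrow{\sim}\underline{A}^+(x,y)$. $\mathbf{V}$ is the (non-symmetric) monoidal category with underlying category $\mathbf{Cat}\times\mathbf{Cat}$, objects $A=(A^+,A^-)$, tensor product $(A\otimes B)^+=(A^+\times B^+)\amalg(A^-\times(B^-)^{\mathrm{op}})$, $(A\otimes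 B)^-=(A^+\times B^-)\amalg(A^-\times(B^+)^{\mathrm{op}})$, and unit $\mathbb{1}=(1,0)$ ($1$ the terminal and $0$ the empty category). A 2-category with contravariance is the same thing as a $\mathbf{V}$-category with $\underline{A}(x,y)=(\underline{A}^+(x,y),\underline{A}^-(x,y))$. The functor $-\otimes B$ has a right adjoint, written $\mathrm{hom}_r(B,-)$, so $\mathbf{V}(A\otimes B,C)\cong\mathbf{V}(A,\mathrm{hom}_r(B,C))$; explicitly $\mathrm{hom}_r(B,C)^+=[B^+,C^+]\times[B^-,C^-]$ and $\mathrm{hom}_r(B,C)^-=[(B^+)^{\mathrm{op}},C^-]\times[(B^-)^{\mathrm{op}},C^+]$. A **copower** of $x\in\underline{A}$ by $\omega\in\mathbf{V}$ is an object $\omega\odot x$ of $\underline{A}$ with isomorphisms $\underline{A}(\omega\odot x,y)\cong\mathrm{hom}_r(\omega,\underline{A}(x,y))$ in $\mathbf{V}$ for all $y$, which are $\mathbf{V}$-natural: for all $y,z$, the composite $\underline{A}(y,z)\otimes\underline{A}(\omega\odot x,y)\to\underline{A}(\omega\odot x,z)\cong\mathrm{hom}_r(\omega,\underline{A}(x,z))$ (first map composition) equals the composite $\underline{A}(y,z)\otimes\underline{A}(\omega\odot x,y)\cong\underline{A}(y,z)\otimes\mathrm{hom}_r(\omega,\underline{A}(x,y))\to\mathrm{hom}_r(\omega,\underline{A}(y,z)\otimes\underline{A}(x,y))\to\mathrm{hom}_r(\omega,\underline{A}(x,z))$ (canonical map followed by composition). *)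

theory Defs
  imports "HOL-Library.FuncSet"
begin

section \<open>Categories, functors and natural transformations\<close>

text \<open>Categories are carrier based; the operations are unconstrained outside the carriers.
  The composite of f followed by g is \<open>Comp C g f\<close>.\<close>

record ('o, 'm) cat =
  Obj :: "'o set"
  Arr :: "'m set"
  Dom :: "'m \<Rightarrow> 'o"
  Cod :: "'m \<Rightarrow> 'o"
  Id :: "'o \<Rightarrow> 'm"
  Comp :: "'m \<Rightarrow> 'm \<Rightarrow> 'm"

locale category =
  fixes C :: "('o, 'm) cat"
  assumes dom_obj: "f \<in> Arr C \<Longrightarrow> Dom C f \<in> Obj C"
    and cod_obj: "f \<in> Arr C \<Longrightarrow> Cod C f \<in> Obj C"
    and id_arr: "a \<in> Obj C \<Longrightarrow> Id C a \<in> Arr C"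
    and dom_id: "a \<in> Obj C \<Longrightarrow> Dom C (Id C a) = a"
    and cod_id: "a \<in> Obj C \<Longrightarrow> Cod C (Id C a) = a"
    and comp_arr: "\<lbrakk>f \<in> Arr C; g \<in> Arr C; Cod C f = Dom C g\<rbrakk> \<Longrightarrow> Comp C g f \<in> Arr C"
    and dom_comp: "\<lbrakk>f \<in> Arr C; g \<in> Arr C; Cod C f = Dom C g\<rbrakk> \<Longrightarrow> Dom C (Comp C g f) = Dom C f"
    and cod_comp: "\<lbrakk>f \<in> Arr C; g \<in> Arr C; Cod C f = Dom C g\<rbrakk> \<Longrightarrow> Cod C (Comp C g f) = Cod C g"
    and comp_id_left: "f \<in> Arr C \<Longrightarrow> Comp C (Id C (Cod C f)) f = f"
    and comp_id_right: "f \<in> Arr C \<Longrightarrow> Comp C f (Id C (Dom C f)) = f"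
    and comp_assoc: "\<lbrakk>f \<in> Arr C; g \<in> Arr C; h \<in> Arr C; Cod C f = Dom C g; Cod C g = Dom C h\<rbrakk>
      \<Longrightarrow> Comp C (Comp C h g) f = Comp C h (Comp C g f)"

text \<open>A functor consists of two maps that are \<^const>\<open>undefined\<close> outside the carriers of its source,
  so that equality of functors is equality of records.  A functor from C to D and the
  functor between the opposite categories that it induces are the same record.\<close>

record ('o, 'm, 'p, 'n) fctr =
  ObjMap :: "'o \<Rightarrow> 'p"
  ArrMap :: "'m \<Rightarrow> 'n"

locale cat_functor = C: category C + D: category D
  for C :: "('o, 'm) cat" and D :: "('p, 'n) cat" +
  fixes F :: "('o, 'm, 'p, 'n) fctr"
  assumes obj_ext: "ObjMap F \<in> extensional (Obj C)"
    and arr_ext: "ArrMap F \<in> extensional (Arr C)"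
    and obj_map: "a \<in> Obj C \<Longrightarrow> ObjMap F a \<in> Obj D"
    and arr_map: "f \<in> Arr C \<Longrightarrow> ArrMap F f \<in> Arr D"
    and map_dom: "f \<in> Arr C \<Longrightarrow> Dom D (ArrMap F f) = ObjMap F (Dom C f)"
    and map_cod: "f \<in> Arr C \<Longrightarrow> Cod D (ArrMap F f) = ObjMap F (Cod C f)"
    and map_id: "a \<in> Obj C \<Longrightarrow> ArrMap F (Id C a) = Id D (ObjMap F a)"
    and map_comp: "\<lbrakk>f \<in> Arr C; g \<in> Arr C; Cod C f = Dom C g\<rbrakk>
      \<Longrightarrow> ArrMap F (Comp C g f) = Comp D (ArrMap F g) (ArrMap F f)"

definition mk_fun :: "('o, 'm) cat \<Rightarrow> ('o \<Rightarrow> 'p) \<Rightarrow> ('m \<Rightarrow> 'n) \<Rightarrow> ('o, 'm, 'p, 'n) fctr" where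
  "mk_fun C fo fa = \<lparr>ObjMap = restrict fo (Obj C), ArrMap = restrict fa (Arr C)\<rparr>"

definition id_fun :: "('o, 'm) cat \<Rightarrow> ('o, 'm, 'o, 'm) fctr" where
  "id_fun C = mk_fun C (\<lambda>a. a) (\<lambda>f. f)"

text \<open>The composite of F followed by G, where C is the source of F.\<close>

definition fun_comp ::
    "('o, 'm) cat \<Rightarrow> ('p, 'n, 'q, 'k) fctr \<Rightarrow> ('o, 'm, 'p, 'n) fctr \<Rightarrow> ('o, 'm, 'q, 'k) fctr" where
  "fun_comp C G F = mk_fun C (\<lambda>a. ObjMap G (ObjMap F a)) (\<lambda>f. ArrMap G (ArrMap F f))"

definition cat_iso :: "('o, 'm) cat \<Rightarrow> ('p, 'n) cat \<Rightarrow> ('o, 'm, 'p, 'n) fctr \<Rightarrow> bool" where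
  "cat_iso C D F \<longleftrightarrow> cat_functor C D F \<and>
    (\<exists>G. cat_functor D C G \<and> fun_comp C G F = id_fun C \<and> fun_comp D F G = id_fun D)"

record ('o, 'm, 'p, 'n) ntrans =
  NDom :: "('o, 'm, 'p, 'n) fctr"
  NCod :: "('o, 'm, 'p, 'n) fctr"
  NMap :: "'o \<Rightarrow> 'n"

locale nat_trans =
  fixes C :: "('o, 'm) cat" and D :: "('p, 'n) cat" and \<eta> :: "('o, 'm, 'p, 'n) ntrans"
  assumes source_functor: "cat_functor C D (NDom \<eta>)"
    and target_functor: "cat_functor C D (NCod \<eta>)"
    and component_ext: "NMap \<eta> \<in> extensional (Obj C)"
    and component_arr: "a \<in> Obj C \<Longrightarrow> NMap \<eta> a \<in> Arr D"
    and component_dom: "a \<in> Obj C \<Longrightarrow> Dom D (NMap \<eta> a) = ObjMap (NDom \<eta>) a"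
    and component_cod: "a \<in> Obj C \<Longrightarrow> Cod D (NMap \<eta> a) = ObjMap (NCod \<eta>) a"
    and naturality: "f \<in> Arr C \<Longrightarrow>
      Comp D (NMap \<eta> (Cod C f)) (ArrMap (NDom \<eta>) f) =
      Comp D (ArrMap (NCod \<eta>) f) (NMap \<eta> (Dom C f))"

section \<open>Constructions in Cat\<close>

definition op_cat :: "('o, 'm) cat \<Rightarrow> ('o, 'm) cat" where
  "op_cat C = \<lparr>Obj = Obj C, Arr = Arr C, Dom = Cod C, Cod = Dom C, Id = Id C,
    Comp = (\<lambda>g f. Comp C f g)\<rparr>"

definition empty_cat :: "(unit, unit) cat" where
  "empty_cat = \<lparr>Obj = {}, Arr = {}, Dom = (\<lambda>_. ()), Cod = (\<lambda>_. ()), Id = (\<lambda>_. ()),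
    Comp = (\<lambda>_ _. ())\<rparr>"

definition terminal_cat :: "(unit, unit) cat" where
  "terminal_cat = \<lparr>Obj = UNIV, Arr = UNIV, Dom = (\<lambda>_. ()), Cod = (\<lambda>_. ()), Id = (\<lambda>_. ()),
    Comp = (\<lambda>_ _. ())\<rparr>"

definition prod_cat :: "('o, 'm) cat \<Rightarrow> ('p, 'n) cat \<Rightarrow> ('o \<times> 'p, 'm \<times> 'n) cat"
    (infixr "\<times>\<^sub>C" 80) where
  "C \<times>\<^sub>C D = \<lparr>Obj = Obj C \<times> Obj D, Arr = Arr C \<times> Arr D,
    Dom = map_prod (Dom C) (Dom D), Cod = map_prod (Cod C) (Cod D),
    Id = map_prod (Id C) (Id D),
    Comp = (\<lambda>g f. (Comp C (fst g) (fst f), Comp D (snd g) (snd f)))\<rparr>"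

text \<open>Arrows of different summands are never composable; the last clause is a dummy.\<close>

definition coprod_cat :: "('o, 'm) cat \<Rightarrow> ('p, 'n) cat \<Rightarrow> ('o + 'p, 'm + 'n) cat"
    (infixr "+\<^sub>C" 75) where
  "C +\<^sub>C D = \<lparr>Obj = Obj C <+> Obj D, Arr = Arr C <+> Arr D,
    Dom = map_sum (Dom C) (Dom D), Cod = map_sum (Cod C) (Cod D),
    Id = map_sum (Id C) (Id D),
    Comp = (\<lambda>g f. case (g, f) of
        (Inl g', Inl f') \<Rightarrow> Inl (Comp C g' f')
      | (Inr g', Inr f') \<Rightarrow> Inr (Comp D g' f')
      | _ \<Rightarrow> undefined)\<rparr>"

definition fun_cat :: "('o, 'm) cat \<Rightarrow> ('p, 'n) cat \<Rightarrow>
    (('o, 'm, 'p, 'n) fctr, ('o, 'm, 'p, 'n) ntrans) cat" where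
  "fun_cat C D = \<lparr>Obj = {F. cat_functor C D F}, Arr = {\<eta>. nat_trans C D \<eta>},
    Dom = NDom, Cod = NCod,
    Id = (\<lambda>F. \<lparr>NDom = F, NCod = F, NMap = (\<lambda>a\<in>Obj C. Id D (ObjMap F a))\<rparr>),
    Comp = (\<lambda>\<theta> \<eta>. \<lparr>NDom = NDom \<eta>, NCod = NCod \<theta>,
      NMap = (\<lambda>a\<in>Obj C. Comp D (NMap \<theta> a) (NMap \<eta> a))\<rparr>)\<rparr>"

definition pair_fun :: "('o, 'm) cat \<Rightarrow> ('o, 'm, 'p, 'n) fctr \<Rightarrow> ('o, 'm, 'q, 'k) fctr \<Rightarrow>
    ('o, 'm, 'p \<times> 'q, 'n \<times> 'k) fctr" where
  "pair_fun C F G = mk_fun C (\<lambda>a. (ObjMap F a, ObjMap G a)) (\<lambda>f. (ArrMap F f, ArrMap G f))"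

definition fst_fun :: "('o, 'm) cat \<Rightarrow> ('p, 'n) cat \<Rightarrow> ('o \<times> 'p, 'm \<times> 'n, 'o, 'm) fctr" where
  "fst_fun C D = mk_fun (C \<times>\<^sub>C D) fst fst"

definition snd_fun :: "('o, 'm) cat \<Rightarrow> ('p, 'n) cat \<Rightarrow> ('o \<times> 'p, 'm \<times> 'n, 'p, 'n) fctr" where
  "snd_fun C D = mk_fun (C \<times>\<^sub>C D) snd snd"

text \<open>In \<open>prod_fun\<close>, \<open>copair_fun\<close> and \<open>coprod_fun\<close> the categories C and D are the sources of
  F and G respectively.\<close>

definition prod_fun :: "('o, 'm) cat \<Rightarrow> ('p, 'n) cat \<Rightarrow>
    ('o, 'm, 'q, 'k) fctr \<Rightarrow> ('p, 'n, 'r, 'l) fctr \<Rightarrow> ('o \<times> 'p, 'm \<times> 'n, 'q \<times> 'r, 'k \<times> 'l) fctr" where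
  "prod_fun C D F G =
    mk_fun (C \<times>\<^sub>C D) (map_prod (ObjMap F) (ObjMap G)) (map_prod (ArrMap F) (ArrMap G))"

definition inl_fun :: "('o, 'm) cat \<Rightarrow> ('o, 'm, 'o + 'p, 'm + 'n) fctr" where
  "inl_fun C = mk_fun C Inl Inl"

definition inr_fun :: "('p, 'n) cat \<Rightarrow> ('p, 'n, 'o + 'p, 'm + 'n) fctr" where
  "inr_fun D = mk_fun D Inr Inr"

definition copair_fun :: "('o, 'm) cat \<Rightarrow> ('p, 'n) cat \<Rightarrow>
    ('o, 'm, 'q, 'k) fctr \<Rightarrow> ('p, 'n, 'q, 'k) fctr \<Rightarrow> ('o + 'p, 'm + 'n, 'q, 'k) fctr" where
  "copair_fun C D F G =
    mk_fun (C +\<^sub>C D) (case_sum (ObjMap F) (ObjMap G)) (case_sum (ArrMap F) (ArrMap G))"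

definition coprod_fun :: "('o, 'm) cat \<Rightarrow> ('p, 'n) cat \<Rightarrow>
    ('o, 'm, 'q, 'k) fctr \<Rightarrow> ('p, 'n, 'r, 'l) fctr \<Rightarrow> ('o + 'p, 'm + 'n, 'q + 'r, 'k + 'l) fctr" where
  "coprod_fun C D F G =
    mk_fun (C +\<^sub>C D) (map_sum (ObjMap F) (ObjMap G)) (map_sum (ArrMap F) (ArrMap G))"

text \<open>The transpose of \<open>H : B \<times>\<^sub>C C \<rightarrow> D\<close>, a functor from B to \<open>fun_cat C D\<close>, and the evaluation
  functor from \<open>fun_cat C D \<times>\<^sub>C C\<close> to D.\<close>

definition curry_obj :: "('a, 'b) cat \<Rightarrow> ('o, 'm) cat \<Rightarrow> ('a \<times> 'o, 'b \<times> 'm, 'p, 'n) fctr \<Rightarrow>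
    'a \<Rightarrow> ('o, 'm, 'p, 'n) fctr" where
  "curry_obj B C H b = mk_fun C (\<lambda>c. ObjMap H (b, c)) (\<lambda>f. ArrMap H (Id B b, f))"

definition curry_fun :: "('a, 'b) cat \<Rightarrow> ('o, 'm) cat \<Rightarrow> ('a \<times> 'o, 'b \<times> 'm, 'p, 'n) fctr \<Rightarrow>
    ('a, 'b, ('o, 'm, 'p, 'n) fctr, ('o, 'm, 'p, 'n) ntrans) fctr" where
  "curry_fun B C H = mk_fun B (curry_obj B C H)
    (\<lambda>g. \<lparr>NDom = curry_obj B C H (Dom B g), NCod = curry_obj B C H (Cod B g),
      NMap = (\<lambda>c\<in>Obj C. ArrMap H (g, Id C c))\<rparr>)"

definition eval_fun :: "('o, 'm) cat \<Rightarrow> ('p, 'n) cat \<Rightarrow>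
    (('o, 'm, 'p, 'n) fctr \<times> 'o, ('o, 'm, 'p, 'n) ntrans \<times> 'm, 'p, 'n) fctr" where
  "eval_fun C D = mk_fun (fun_cat C D \<times>\<^sub>C C) (\<lambda>(F, c). ObjMap F c)
    (\<lambda>(\<eta>, f). Comp D (NMap \<eta> (Cod C f)) (ArrMap (NDom \<eta>) f))"

section \<open>The monoidal category V\<close>

datatype sign = Pos | Neg

text \<open>The sign of a composite is the product of the signs.\<close>

instantiation sign :: comm_monoid_mult
begin

definition one_sign :: sign where "1 = Pos"

fun times_sign :: "sign \<Rightarrow> sign \<Rightarrow> sign" where
  "Pos * s = s"
| "Neg * Pos = Neg"
| "Neg * Neg = Pos"

instance
proof
  fix a b c :: sign
  show "a * b * c = a * (b * c)" by (cases a; cases b; cases c) simp_all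
  show "a * b = b * a" by (cases a; cases b) simp_all
  show "1 * a = a" by (simp add: one_sign_def)
qed

end

type_synonym ('o, 'm) vobj = "sign \<Rightarrow> ('o, 'm) cat"
type_synonym ('o, 'm, 'p, 'n) vmor = "sign \<Rightarrow> ('o, 'm, 'p, 'n) fctr"

definition v_obj :: "('o, 'm) vobj \<Rightarrow> bool" where
  "v_obj A \<longleftrightarrow> (\<forall>s. category (A s))"

definition v_mor :: "('o, 'm) vobj \<Rightarrow> ('p, 'n) vobj \<Rightarrow> ('o, 'm, 'p, 'n) vmor \<Rightarrow> bool" where
  "v_mor A B F \<longleftrightarrow> (\<forall>s. cat_functor (A s) (B s) (F s))"

definition v_id :: "('o, 'm) vobj \<Rightarrow> ('o, 'm, 'o, 'm) vmor" where
  "v_id A s = id_fun (A s)"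

definition v_comp :: "('o, 'm) vobj \<Rightarrow> ('p, 'n, 'q, 'k) vmor \<Rightarrow> ('o, 'm, 'p, 'n) vmor \<Rightarrow>
    ('o, 'm, 'q, 'k) vmor" where
  "v_comp A G F s = fun_comp (A s) (G s) (F s)"

definition v_iso :: "('o, 'm) vobj \<Rightarrow> ('p, 'n) vobj \<Rightarrow> ('o, 'm, 'p, 'n) vmor \<Rightarrow> bool" where
  "v_iso A B F \<longleftrightarrow> v_mor A B F \<and>
    (\<exists>G. v_mor B A G \<and> v_comp A G F = v_id A \<and> v_comp B F G = v_id B)"

fun v_unit :: "(unit, unit) vobj" where
  "v_unit Pos = terminal_cat"
| "v_unit Neg = empty_cat"

fun dual_unit :: "(unit, unit) vobj" where
  "dual_unit Pos = empty_cat"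
| "dual_unit Neg = terminal_cat"

fun tensor :: "('o, 'm) vobj \<Rightarrow> ('p, 'n) vobj \<Rightarrow>
    ('o \<times> 'p + 'o \<times> 'p, 'm \<times> 'n + 'm \<times> 'n) vobj" (infixr "\<otimes>\<^sub>V" 70) where
  "(A \<otimes>\<^sub>V B) Pos = (A Pos \<times>\<^sub>C B Pos) +\<^sub>C (A Neg \<times>\<^sub>C op_cat (B Neg))"
| "(A \<otimes>\<^sub>V B) Neg = (A Pos \<times>\<^sub>C B Neg) +\<^sub>C (A Neg \<times>\<^sub>C op_cat (B Pos))"

text \<open>A and B are the sources of F and G.\<close>

fun tensor_mor :: "('o, 'm) vobj \<Rightarrow> ('p, 'n) vobj \<Rightarrow>
    ('o, 'm, 'q, 'k) vmor \<Rightarrow> ('p, 'n, 'r, 'l) vmor \<Rightarrow>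
    ('o \<times> 'p + 'o \<times> 'p, 'm \<times> 'n + 'm \<times> 'n, 'q \<times> 'r + 'q \<times> 'r, 'k \<times> 'l + 'k \<times> 'l) vmor" where
  "tensor_mor A B F G Pos =
    coprod_fun (A Pos \<times>\<^sub>C B Pos) (A Neg \<times>\<^sub>C op_cat (B Neg))
      (prod_fun (A Pos) (B Pos) (F Pos) (G Pos))
      (prod_fun (A Neg) (op_cat (B Neg)) (F Neg) (G Neg))"
| "tensor_mor A B F G Neg =
    coprod_fun (A Pos \<times>\<^sub>C B Neg) (A Neg \<times>\<^sub>C op_cat (B Pos))
      (prod_fun (A Pos) (B Neg) (F Pos) (G Neg))
      (prod_fun (A Neg) (op_cat (B Pos)) (F Neg) (G Pos))"

text \<open>The associator is given by the same formula in both signs, on objects and on arrows.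
  For example, in sign \<^const>\<open>Pos\<close> the second clause sends the summand
  \<open>(A\<^sup>- \<times> (B\<^sup>-)\<^sup>o\<^sup>p) \<times> C\<^sup>+\<close> to \<open>A\<^sup>- \<times> (B\<^sup>- \<times> (C\<^sup>+)\<^sup>o\<^sup>p)\<^sup>o\<^sup>p\<close>.\<close>

fun assoc_map :: "('a \<times> 'b + 'a \<times> 'b) \<times> 'c + ('a \<times> 'b + 'a \<times> 'b) \<times> 'c \<Rightarrow>
    'a \<times> ('b \<times> 'c + 'b \<times> 'c) + 'a \<times> ('b \<times> 'c + 'b \<times> 'c)" where
  "assoc_map (Inl (Inl (a, b), c)) = Inl (a, Inl (b, c))"
| "assoc_map (Inl (Inr (a, b), c)) = Inr (a, Inr (b, c))"
| "assoc_map (Inr (Inl (a, b), c)) = Inl (a, Inr (b, c))"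
| "assoc_map (Inr (Inr (a, b), c)) = Inr (a, Inl (b, c))"

definition v_assoc where
  "v_assoc A B C s = mk_fun (((A \<otimes>\<^sub>V B) \<otimes>\<^sub>V C) s) assoc_map assoc_map"

definition v_lunit where
  "v_lunit A s = mk_fun ((v_unit \<otimes>\<^sub>V A) s) (case_sum snd snd) (case_sum snd snd)"

definition v_runit where
  "v_runit A s = mk_fun ((A \<otimes>\<^sub>V v_unit) s) (case_sum fst fst) (case_sum fst fst)"

fun hom_r :: "('p, 'n) vobj \<Rightarrow> ('q, 'k) vobj \<Rightarrow>
    (('p, 'n, 'q, 'k) fctr \<times> ('p, 'n, 'q, 'k) fctr,
     ('p, 'n, 'q, 'k) ntrans \<times> ('p, 'n, 'q, 'k) ntrans) vobj" where
  "hom_r B C Pos = fun_cat (B Pos) (C Pos) \<times>\<^sub>C fun_cat (B Neg) (C Neg)"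
| "hom_r B C Neg = fun_cat (op_cat (B Pos)) (C Neg) \<times>\<^sub>C fun_cat (op_cat (B Neg)) (C Pos)"

text \<open>The adjunction between tensoring with B on the right and \<open>hom_r B\<close>: the transpose
  \<open>A \<rightarrow> hom_r B C\<close> of \<open>H : A \<otimes>\<^sub>V B \<rightarrow> C\<close>, and the counit \<open>hom_r B C \<otimes>\<^sub>V B \<rightarrow> C\<close>.\<close>

fun v_curry :: "('o, 'm) vobj \<Rightarrow> ('p, 'n) vobj \<Rightarrow>
    ('o \<times> 'p + 'o \<times> 'p, 'm \<times> 'n + 'm \<times> 'n, 'q, 'k) vmor \<Rightarrow>
    ('o, 'm, ('p, 'n, 'q, 'k) fctr \<times> ('p, 'n, 'q, 'k) fctr,
     ('p, 'n, 'q, 'k) ntrans \<times> ('p, 'n, 'q, 'k) ntrans) vmor" where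
  "v_curry A B H Pos = pair_fun (A Pos)
    (curry_fun (A Pos) (B Pos)
      (fun_comp (A Pos \<times>\<^sub>C B Pos) (H Pos) (inl_fun (A Pos \<times>\<^sub>C B Pos))))
    (curry_fun (A Pos) (B Neg)
      (fun_comp (A Pos \<times>\<^sub>C B Neg) (H Neg) (inl_fun (A Pos \<times>\<^sub>C B Neg))))"
| "v_curry A B H Neg = pair_fun (A Neg)
    (curry_fun (A Neg) (op_cat (B Pos))
      (fun_comp (A Neg \<times>\<^sub>C op_cat (B Pos)) (H Neg) (inr_fun (A Neg \<times>\<^sub>C op_cat (B Pos)))))
    (curry_fun (A Neg) (op_cat (B Neg))
      (fun_comp (A Neg \<times>\<^sub>C op_cat (B Neg)) (H Pos) (inr_fun (A Neg \<times>\<^sub>C op_cat (B Neg)))))"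

fun v_eval :: "('p, 'n) vobj \<Rightarrow> ('q, 'k) vobj \<Rightarrow>
    ((('p, 'n, 'q, 'k) fctr \<times> ('p, 'n, 'q, 'k) fctr) \<times> 'p +
     (('p, 'n, 'q, 'k) fctr \<times> ('p, 'n, 'q, 'k) fctr) \<times> 'p,
     (('p, 'n, 'q, 'k) ntrans \<times> ('p, 'n, 'q, 'k) ntrans) \<times> 'n +
     (('p, 'n, 'q, 'k) ntrans \<times> ('p, 'n, 'q, 'k) ntrans) \<times> 'n, 'q, 'k) vmor" where
  "v_eval B C Pos =
    copair_fun (hom_r B C Pos \<times>\<^sub>C B Pos) (hom_r B C Neg \<times>\<^sub>C op_cat (B Neg))
      (fun_comp (hom_r B C Pos \<times>\<^sub>C B Pos) (eval_fun (B Pos) (C Pos))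
        (prod_fun (hom_r B C Pos) (B Pos)
          (fst_fun (fun_cat (B Pos) (C Pos)) (fun_cat (B Neg) (C Neg)))
          (id_fun (B Pos))))
      (fun_comp (hom_r B C Neg \<times>\<^sub>C op_cat (B Neg)) (eval_fun (op_cat (B Neg)) (C Pos))
        (prod_fun (hom_r B C Neg) (op_cat (B Neg))
          (snd_fun (fun_cat (op_cat (B Pos)) (C Neg)) (fun_cat (op_cat (B Neg)) (C Pos)))
          (id_fun (op_cat (B Neg)))))"
| "v_eval B C Neg =
    copair_fun (hom_r B C Pos \<times>\<^sub>C B Neg) (hom_r B C Neg \<times>\<^sub>C op_cat (B Pos))
      (fun_comp (hom_r B C Pos \<times>\<^sub>C B Neg) (eval_fun (B Neg) (C Neg))
        (prod_fun (hom_r B C Pos) (B Neg)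
          (snd_fun (fun_cat (B Pos) (C Pos)) (fun_cat (B Neg) (C Neg)))
          (id_fun (B Neg))))
      (fun_comp (hom_r B C Neg \<times>\<^sub>C op_cat (B Pos)) (eval_fun (op_cat (B Pos)) (C Neg))
        (prod_fun (hom_r B C Neg) (op_cat (B Pos))
          (fst_fun (fun_cat (op_cat (B Pos)) (C Neg)) (fun_cat (op_cat (B Neg)) (C Pos)))
          (id_fun (op_cat (B Pos)))))"

text \<open>The action of \<open>hom_r B\<close> on \<open>F : C \<rightarrow> D\<close>, as the transpose of
  \<open>hom_r B C \<otimes>\<^sub>V B \<rightarrow> C \<rightarrow> D\<close>.\<close>

definition hom_r_mor where
  "hom_r_mor B C F = v_curry (hom_r B C) B (v_comp (hom_r B C \<otimes>\<^sub>V B) F (v_eval B C))"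

text \<open>The canonical morphism \<open>A \<otimes>\<^sub>V hom_r B C \<rightarrow> hom_r B (A \<otimes>\<^sub>V C)\<close>, as the transpose of
  \<open>(A \<otimes>\<^sub>V hom_r B C) \<otimes>\<^sub>V B \<rightarrow> A \<otimes>\<^sub>V (hom_r B C \<otimes>\<^sub>V B) \<rightarrow> A \<otimes>\<^sub>V C\<close>.\<close>

definition tensor_hom_r where
  "tensor_hom_r A B C = v_curry (A \<otimes>\<^sub>V hom_r B C) B
    (v_comp ((A \<otimes>\<^sub>V hom_r B C) \<otimes>\<^sub>V B)
      (tensor_mor A (hom_r B C \<otimes>\<^sub>V B) (v_id A) (v_eval B C))
      (v_assoc A (hom_r B C) B))"

section \<open>V-categories and copowers\<close>

record ('x, 'o, 'm) vcat =
  VOb :: "'x set"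
  VHom :: "'x \<Rightarrow> 'x \<Rightarrow> ('o, 'm) vobj"
  VUnit :: "'x \<Rightarrow> (unit, unit, 'o, 'm) vmor"
  VComp :: "'x \<Rightarrow> 'x \<Rightarrow> 'x \<Rightarrow> ('o \<times> 'o + 'o \<times> 'o, 'm \<times> 'm + 'm \<times> 'm, 'o, 'm) vmor"

text \<open>\<open>VComp K x y z\<close> is the composition \<open>VHom K y z \<otimes>\<^sub>V VHom K x y \<rightarrow> VHom K x z\<close>.\<close>

locale v_category =
  fixes K :: "('x, 'o, 'm) vcat"
  assumes v_hom: "\<lbrakk>x \<in> VOb K; y \<in> VOb K\<rbrakk> \<Longrightarrow> v_obj (VHom K x y)"
    and v_unit_mor: "x \<in> VOb K \<Longrightarrow> v_mor v_unit (VHom K x x) (VUnit K x)"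
    and v_comp_mor: "\<lbrakk>x \<in> VOb K; y \<in> VOb K; z \<in> VOb K\<rbrakk> \<Longrightarrow>
      v_mor (VHom K y z \<otimes>\<^sub>V VHom K x y) (VHom K x z) (VComp K x y z)"
    and v_unit_left: "\<lbrakk>x \<in> VOb K; y \<in> VOb K\<rbrakk> \<Longrightarrow>
      v_comp (v_unit \<otimes>\<^sub>V VHom K x y) (VComp K x y y)
        (tensor_mor v_unit (VHom K x y) (VUnit K y) (v_id (VHom K x y)))
      = v_lunit (VHom K x y)"
    and v_unit_right: "\<lbrakk>x \<in> VOb K; y \<in> VOb K\<rbrakk> \<Longrightarrow>
      v_comp (VHom K x y \<otimes>\<^sub>V v_unit) (VComp K x x y)
        (tensor_mor (VHom K x y) v_unit (v_id (VHom K x y)) (VUnit K x))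
      = v_runit (VHom K x y)"
    and v_comp_assoc: "\<lbrakk>x \<in> VOb K; y \<in> VOb K; z \<in> VOb K; w \<in> VOb K\<rbrakk> \<Longrightarrow>
      v_comp ((VHom K z w \<otimes>\<^sub>V VHom K y z) \<otimes>\<^sub>V VHom K x y) (VComp K x y w)
        (tensor_mor (VHom K z w \<otimes>\<^sub>V VHom K y z) (VHom K x y)
          (VComp K y z w) (v_id (VHom K x y)))
      = v_comp ((VHom K z w \<otimes>\<^sub>V VHom K y z) \<otimes>\<^sub>V VHom K x y) (VComp K x z w)
          (v_comp ((VHom K z w \<otimes>\<^sub>V VHom K y z) \<otimes>\<^sub>V VHom K x y)
            (tensor_mor (VHom K z w) (VHom K y z \<otimes>\<^sub>V VHom K x y)
              (v_id (VHom K z w)) (VComp K x y z))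
            (v_assoc (VHom K z w) (VHom K y z) (VHom K x y)))"

text \<open>The object c with the isomorphisms \<open>\<phi> y : VHom K c y \<rightarrow> hom_r \<omega> (VHom K x y)\<close> is a copower
  of x by \<open>\<omega>\<close>.\<close>

definition is_copower where
  "is_copower K \<omega> x c \<phi> \<longleftrightarrow>
    c \<in> VOb K \<and>
    (\<forall>y\<in>VOb K. v_iso (VHom K c y) (hom_r \<omega> (VHom K x y)) (\<phi> y)) \<and>
    (\<forall>y\<in>VOb K. \<forall>z\<in>VOb K.
      v_comp (VHom K y z \<otimes>\<^sub>V VHom K c y) (\<phi> z) (VComp K c y z) =
      v_comp (VHom K y z \<otimes>\<^sub>V VHom K c y)
        (hom_r_mor \<omega> (VHom K y z \<otimes>\<^sub>V VHom K x y) (VComp K x y z))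
        (v_comp (VHom K y z \<otimes>\<^sub>V VHom K c y)
          (tensor_hom_r (VHom K y z) \<omega> (VHom K x y))
          (tensor_mor (VHom K y z) (VHom K c y) (v_id (VHom K y z)) (\<phi> y))))"

definition has_copowers_by where
  "has_copowers_by K \<omega> \<longleftrightarrow> (\<forall>x\<in>VOb K. \<exists>c \<phi>. is_copower K \<omega> x c \<phi>)"

section \<open>2-categories with contravariance\<close>

fun twist :: "sign \<Rightarrow> ('o, 'm) cat \<Rightarrow> ('o, 'm) cat" where
  "twist Pos C = C"
| "twist Neg C = op_cat C"

text \<open>\<open>CComp A s t x y z\<close> composes 1-cells of sign s from y to z with 1-cells of sign t from
  x to y; the four sign combinations are the four composition functors.\<close>

record ('x, 'o, 'm) contra_2cat =
  Ob :: "'x set"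
  Hom :: "sign \<Rightarrow> 'x \<Rightarrow> 'x \<Rightarrow> ('o, 'm) cat"
  CUnit :: "'x \<Rightarrow> 'o"
  CComp :: "sign \<Rightarrow> sign \<Rightarrow> 'x \<Rightarrow> 'x \<Rightarrow> 'x \<Rightarrow> ('o \<times> 'o, 'm \<times> 'm, 'o, 'm) fctr"

locale contravariance_2category =
  fixes A :: "('x, 'o, 'm) contra_2cat"
  assumes hom_category: "\<lbrakk>x \<in> Ob A; y \<in> Ob A\<rbrakk> \<Longrightarrow> category (Hom A s x y)"
    and unit_obj: "x \<in> Ob A \<Longrightarrow> CUnit A x \<in> Obj (Hom A Pos x x)"
    and comp_functor: "\<lbrakk>x \<in> Ob A; y \<in> Ob A; z \<in> Ob A\<rbrakk> \<Longrightarrow>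
      cat_functor (Hom A s y z \<times>\<^sub>C twist s (Hom A t x y)) (Hom A (s * t) x z) (CComp A s t x y z)"
    and unit_left_obj: "\<lbrakk>x \<in> Ob A; y \<in> Ob A; f \<in> Obj (Hom A s x y)\<rbrakk> \<Longrightarrow>
      ObjMap (CComp A Pos s x y y) (CUnit A y, f) = f"
    and unit_left_arr: "\<lbrakk>x \<in> Ob A; y \<in> Ob A; \<alpha> \<in> Arr (Hom A s x y)\<rbrakk> \<Longrightarrow>
      ArrMap (CComp A Pos s x y y) (Id (Hom A Pos y y) (CUnit A y), \<alpha>) = \<alpha>"
    and unit_right_obj: "\<lbrakk>x \<in> Ob A; y \<in> Ob A; f \<in> Obj (Hom A s x y)\<rbrakk> \<Longrightarrow>
      ObjMap (CComp A s Pos x x y) (f, CUnit A x) = f"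
    and unit_right_arr: "\<lbrakk>x \<in> Ob A; y \<in> Ob A; \<alpha> \<in> Arr (Hom A s x y)\<rbrakk> \<Longrightarrow>
      ArrMap (CComp A s Pos x x y) (\<alpha>, Id (Hom A Pos x x) (CUnit A x)) = \<alpha>"
    and assoc_obj: "\<lbrakk>w \<in> Ob A; x \<in> Ob A; y \<in> Ob A; z \<in> Ob A;
        h \<in> Obj (Hom A r y z); g \<in> Obj (Hom A s x y); f \<in> Obj (Hom A t w x)\<rbrakk> \<Longrightarrow>
      ObjMap (CComp A (r * s) t w x z) (ObjMap (CComp A r s x y z) (h, g), f) =
      ObjMap (CComp A r (s * t) w y z) (h, ObjMap (CComp A s t w x y) (g, f))"
    and assoc_arr: "\<lbrakk>w \<in> Ob A; x \<in> Ob A; y \<in> Ob A; z \<in> Ob A;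
        \<gamma> \<in> Arr (Hom A r y z); \<beta> \<in> Arr (Hom A s x y); \<alpha> \<in> Arr (Hom A t w x)\<rbrakk> \<Longrightarrow>
      ArrMap (CComp A (r * s) t w x z) (ArrMap (CComp A r s x y z) (\<gamma>, \<beta>), \<alpha>) =
      ArrMap (CComp A r (s * t) w y z) (\<gamma>, ArrMap (CComp A s t w x y) (\<beta>, \<alpha>))"

text \<open>Precomposition with a 1-cell k of sign t from x to x', as a functor from
  \<open>Hom A s x' y\<close> to \<open>Hom A (s * t) x y\<close>.\<close>

definition precomp_fun :: "('x, 'o, 'm) contra_2cat \<Rightarrow> sign \<Rightarrow> 'x \<Rightarrow> 'x \<Rightarrow> 'o \<Rightarrow> sign \<Rightarrow> 'x \<Rightarrow>
    ('o, 'm, 'o, 'm) fctr" where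
  "precomp_fun A t x x' k s y = mk_fun (Hom A s x' y)
    (\<lambda>f. ObjMap (CComp A s t x x' y) (f, k))
    (\<lambda>\<alpha>. ArrMap (CComp A s t x x' y) (\<alpha>, Id (Hom A t x x') k))"

definition strict_opposite :: "('x, 'o, 'm) contra_2cat \<Rightarrow> 'x \<Rightarrow> 'x \<Rightarrow> 'o \<Rightarrow> bool" where
  "strict_opposite A x x' \<chi> \<longleftrightarrow>
    x' \<in> Ob A \<and> \<chi> \<in> Obj (Hom A Neg x x') \<and>
    (\<forall>y\<in>Ob A.
      cat_iso (Hom A Pos x' y) (Hom A Neg x y) (precomp_fun A Neg x x' \<chi> Pos y) \<and>
      cat_iso (Hom A Neg x' y) (Hom A Pos x y) (precomp_fun A Neg x x' \<chi> Neg y))"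

text \<open>A 2-category with contravariance, regarded as a V-category.  In sign \<^const>\<open>Neg\<close> the unit
  is a functor out of the empty category.\<close>

fun vcat_unit :: "('x, 'o, 'm) contra_2cat \<Rightarrow> 'x \<Rightarrow> (unit, unit, 'o, 'm) vmor" where
  "vcat_unit A x Pos =
    mk_fun terminal_cat (\<lambda>_. CUnit A x) (\<lambda>_. Id (Hom A Pos x x) (CUnit A x))"
| "vcat_unit A x Neg = mk_fun empty_cat (\<lambda>_. undefined) (\<lambda>_. undefined)"

fun vcat_comp :: "('x, 'o, 'm) contra_2cat \<Rightarrow> 'x \<Rightarrow> 'x \<Rightarrow> 'x \<Rightarrow>
    ('o \<times> 'o + 'o \<times> 'o, 'm \<times> 'm + 'm \<times> 'm, 'o, 'm) vmor" where
  "vcat_comp A x y z Pos =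
    copair_fun (Hom A Pos y z \<times>\<^sub>C Hom A Pos x y) (Hom A Neg y z \<times>\<^sub>C op_cat (Hom A Neg x y))
      (CComp A Pos Pos x y z) (CComp A Neg Neg x y z)"
| "vcat_comp A x y z Neg =
    copair_fun (Hom A Pos y z \<times>\<^sub>C Hom A Neg x y) (Hom A Neg y z \<times>\<^sub>C op_cat (Hom A Pos x y))
      (CComp A Pos Neg x y z) (CComp A Neg Pos x y z)"

definition vcat_of :: "('x, 'o, 'm) contra_2cat \<Rightarrow> ('x, 'o, 'm) vcat" where
  "vcat_of A = \<lparr>VOb = Ob A, VHom = (\<lambda>x y s. Hom A s x y), VUnit = vcat_unit A,
    VComp = vcat_comp A\<rparr>"

section \<open>A 2-category with contravariance is a V-category\<close>

lemma all_sign: "(\<forall>s. P s) \<longleftrightarrow> P Pos \<and> P Neg"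
  by (metis sign.exhaust)

lemmas category_laws = category.dom_obj category.cod_obj category.id_arr category.dom_id
  category.cod_id category.comp_arr category.dom_comp category.cod_comp category.comp_id_left
  category.comp_id_right category.comp_assoc

lemma comp_id_id: "category C \<Longrightarrow> a \<in> Obj C \<Longrightarrow> Comp C (Id C a) (Id C a) = Id C a"
  using category.comp_id_left[of C "Id C a"] by (simp add: category_laws)

lemma category_op: "category C \<Longrightarrow> category (op_cat C)"
  by (rule category.intro) (simp_all add: op_cat_def category_laws)

lemma category_terminal: "category terminal_cat"
  by (rule category.intro) (simp_all add: terminal_cat_def)

lemma category_empty: "category empty_cat"
  by (rule category.intro) (simp_all add: empty_cat_def)

lemma category_coprod: "category C \<Longrightarrow> category D \<Longrightarrow> category (C +\<^sub>C D)"
  by (rule category.intro) (auto simp: coprod_cat_def category_laws)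

lemmas functor_laws = cat_functor.obj_map cat_functor.arr_map cat_functor.map_dom
  cat_functor.map_cod cat_functor.map_id cat_functor.map_comp

lemma functor_copair:
  assumes F: "cat_functor C E F" and G: "cat_functor D E G"
  shows "cat_functor (C +\<^sub>C D) E (copair_fun C D F G)"
proof -
  interpret F: cat_functor C E F by fact
  interpret G: cat_functor D E G by fact
  interpret CD: category "C +\<^sub>C D"
    by (intro category_coprod F.C.category_axioms G.C.category_axioms)
  show ?thesis
    by unfold_locales
      (auto simp: copair_fun_def mk_fun_def coprod_cat_def category_laws[OF F.C.category_axioms]
        category_laws[OF G.C.category_axioms] functor_laws[OF F] functor_laws[OF G])
qed

lemma mk_fun_cong:
  "(\<And>a. a \<in> Obj C \<Longrightarrow> f a = f' a) \<Longrightarrow> (\<And>a. a \<in> Arr C \<Longrightarrow> g a = g' a) \<Longrightarrow> mk_fun C f g = mk_fun C f' g'"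
  unfolding mk_fun_def by (auto simp: restrict_def)

lemma Plus_iff: "Inl x \<in> P <+> Q \<longleftrightarrow> x \<in> P" "Inr y \<in> P <+> Q \<longleftrightarrow> y \<in> Q"
  by auto

lemma tensor_carrier:
  "Obj ((A \<otimes>\<^sub>V B) s) = Obj (A Pos) \<times> Obj (B s) <+> Obj (A Neg) \<times> Obj (B (Neg * s))"
  "Arr ((A \<otimes>\<^sub>V B) s) = Arr (A Pos) \<times> Arr (B s) <+> Arr (A Neg) \<times> Arr (B (Neg * s))"
  by (case_tac [!] s) (simp_all add: Plus_iff coprod_cat_def prod_cat_def op_cat_def)

lemma tensor_mor_simps:
  "a \<in> Obj (A Pos) \<Longrightarrow> b \<in> Obj (B s) \<Longrightarrow>
    ObjMap (tensor_mor A B F G s) (Inl (a, b)) = Inl (ObjMap (F Pos) a, ObjMap (G s) b)"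
  "a \<in> Obj (A Neg) \<Longrightarrow> b \<in> Obj (B (Neg * s)) \<Longrightarrow>
    ObjMap (tensor_mor A B F G s) (Inr (a, b)) = Inr (ObjMap (F Neg) a, ObjMap (G (Neg * s)) b)"
  "f \<in> Arr (A Pos) \<Longrightarrow> g \<in> Arr (B s) \<Longrightarrow>
    ArrMap (tensor_mor A B F G s) (Inl (f, g)) = Inl (ArrMap (F Pos) f, ArrMap (G s) g)"
  "f \<in> Arr (A Neg) \<Longrightarrow> g \<in> Arr (B (Neg * s)) \<Longrightarrow>
    ArrMap (tensor_mor A B F G s) (Inr (f, g)) = Inr (ArrMap (F Neg) f, ArrMap (G (Neg * s)) g)"
  by (case_tac [!] s) (simp_all add: Plus_iff coprod_fun_def prod_fun_def mk_fun_def coprod_cat_def prod_cat_def op_cat_def)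

lemma vcat_comp_simps:
  "g \<in> Obj (Hom A Pos y z) \<Longrightarrow> f \<in> Obj (Hom A s x y) \<Longrightarrow>
    ObjMap (vcat_comp A x y z s) (Inl (g, f)) = ObjMap (CComp A Pos s x y z) (g, f)"
  "g \<in> Obj (Hom A Neg y z) \<Longrightarrow> f \<in> Obj (Hom A (Neg * s) x y) \<Longrightarrow>
    ObjMap (vcat_comp A x y z s) (Inr (g, f)) = ObjMap (CComp A Neg (Neg * s) x y z) (g, f)"
  "\<beta> \<in> Arr (Hom A Pos y z) \<Longrightarrow> \<alpha> \<in> Arr (Hom A s x y) \<Longrightarrow>
    ArrMap (vcat_comp A x y z s) (Inl (\<beta>, \<alpha>)) = ArrMap (CComp A Pos s x y z) (\<beta>, \<alpha>)"
  "\<beta> \<in> Arr (Hom A Neg y z) \<Longrightarrow> \<alpha> \<in> Arr (Hom A (Neg * s) x y) \<Longrightarrow>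
    ArrMap (vcat_comp A x y z s) (Inr (\<beta>, \<alpha>)) = ArrMap (CComp A Neg (Neg * s) x y z) (\<beta>, \<alpha>)"
  by (case_tac [!] s) (simp_all add: Plus_iff copair_fun_def mk_fun_def coprod_cat_def prod_cat_def op_cat_def)

lemma (in contravariance_2category) v_category_vcat_of: "v_category (vcat_of A)"
proof
  fix x y assume xy: "x \<in> VOb (vcat_of A)" "y \<in> VOb (vcat_of A)"
  then have X: "x \<in> Ob A" "y \<in> Ob A" by (auto simp: vcat_of_def)
  note H = hom_category
  show "v_obj (VHom (vcat_of A) x y)" using X by (auto simp: vcat_of_def v_obj_def H)
  show "v_mor v_unit (VHom (vcat_of A) x x) (VUnit (vcat_of A) x)"
    unfolding v_mor_def
  proof
    fix s
    interpret E: category empty_cat by (rule category_empty)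
    interpret T: category terminal_cat by (rule category_terminal)
    interpret XX: category "Hom A s x x" by (rule H[OF X(1) X(1)])
    show "cat_functor (v_unit s) (VHom (vcat_of A) x x s) (VUnit (vcat_of A) x s)"
      using unit_obj[OF X(1)] E.category_axioms T.category_axioms XX.category_axioms
      by (cases s) (auto simp: cat_functor_def cat_functor_axioms_def vcat_of_def mk_fun_def
        terminal_cat_def empty_cat_def category_laws comp_id_id)
  qed
  show "v_comp (v_unit \<otimes>\<^sub>V VHom (vcat_of A) x y) (VComp (vcat_of A) x y y)
        (tensor_mor v_unit (VHom (vcat_of A) x y) (VUnit (vcat_of A) y) (v_id (VHom (vcat_of A) x y)))
      = v_lunit (VHom (vcat_of A) x y)" (is "?l = ?r")
  proof
    fix s show "?l s = ?r s"
      using X unit_obj[OF X(2)] category.id_arr[OF H[OF X(2) X(2)] unit_obj[OF X(2)]]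
      unfolding v_comp_def v_lunit_def fun_comp_def
      by (cases s; intro mk_fun_cong)
        (auto simp: vcat_of_def tensor_carrier Plus_iff tensor_mor_simps vcat_comp_simps
          mk_fun_def v_id_def id_fun_def terminal_cat_def empty_cat_def unit_left_obj unit_left_arr
          simp del: tensor.simps tensor_mor.simps vcat_comp.simps)
  qed
  show "v_comp (VHom (vcat_of A) x y \<otimes>\<^sub>V v_unit) (VComp (vcat_of A) x x y)
        (tensor_mor (VHom (vcat_of A) x y) v_unit (v_id (VHom (vcat_of A) x y)) (VUnit (vcat_of A) x))
      = v_runit (VHom (vcat_of A) x y)" (is "?l = ?r")
  proof
    fix s show "?l s = ?r s"
      using X unit_obj[OF X(1)] category.id_arr[OF H[OF X(1) X(1)] unit_obj[OF X(1)]]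
      unfolding v_comp_def v_runit_def fun_comp_def
      by (cases s; intro mk_fun_cong)
        (auto simp: vcat_of_def tensor_carrier Plus_iff tensor_mor_simps vcat_comp_simps
          mk_fun_def v_id_def id_fun_def terminal_cat_def empty_cat_def unit_right_obj unit_right_arr
          simp del: tensor.simps tensor_mor.simps vcat_comp.simps)
  qed
next
  fix x y z assume xy: "x \<in> VOb (vcat_of A)" "y \<in> VOb (vcat_of A)" "z \<in> VOb (vcat_of A)"
  then have X: "x \<in> Ob A" "y \<in> Ob A" "z \<in> Ob A" by (auto simp: vcat_of_def)
  show "v_mor (VHom (vcat_of A) y z \<otimes>\<^sub>V VHom (vcat_of A) x y) (VHom (vcat_of A) x z) (VComp (vcat_of A) x y z)"
    using comp_functor[OF X, of Pos Pos] comp_functor[OF X, of Pos Neg]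
      comp_functor[OF X, of Neg Pos] comp_functor[OF X, of Neg Neg]
    by (auto simp: v_mor_def all_sign vcat_of_def intro!: functor_copair)
next
  fix x y z w assume xy: "x \<in> VOb (vcat_of A)" "y \<in> VOb (vcat_of A)" "z \<in> VOb (vcat_of A)" "w \<in> VOb (vcat_of A)"
  then have X: "x \<in> Ob A" "y \<in> Ob A" "z \<in> Ob A" "w \<in> Ob A" by (auto simp: vcat_of_def)
  have O: "ObjMap (CComp A s t x y z) (g, f) \<in> Obj (Hom A u x z)"
    if "x \<in> Ob A" "y \<in> Ob A" "z \<in> Ob A" "g \<in> Obj (Hom A s y z)" "f \<in> Obj (Hom A t x y)" "u = s * t"
    for x y z s t u f g
    using cat_functor.obj_map[OF comp_functor[OF that(1-3)], of "(g, f)" s t] that(4-)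
    by (cases s) (simp_all add: prod_cat_def op_cat_def)
  have M: "ArrMap (CComp A s t x y z) (g, f) \<in> Arr (Hom A u x z)"
    if "x \<in> Ob A" "y \<in> Ob A" "z \<in> Ob A" "g \<in> Arr (Hom A s y z)" "f \<in> Arr (Hom A t x y)" "u = s * t"
    for x y z s t u f g
    using cat_functor.arr_map[OF comp_functor[OF that(1-3)], of "(g, f)" s t] that(4-)
    by (cases s) (simp_all add: prod_cat_def op_cat_def)
  have aO: "ObjMap (CComp A u t x y w) (ObjMap (CComp A r s y z w) (h, g), f) =
      ObjMap (CComp A r (s * t) x z w) (h, ObjMap (CComp A s t x y z) (g, f))"
    if "u = r * s" "h \<in> Obj (Hom A r z w)" "g \<in> Obj (Hom A s y z)" "f \<in> Obj (Hom A t x y)" for u r s t h g f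
    using assoc_obj[OF X] that by simp
  have aM: "ArrMap (CComp A u t x y w) (ArrMap (CComp A r s y z w) (h, g), f) =
      ArrMap (CComp A r (s * t) x z w) (h, ArrMap (CComp A s t x y z) (g, f))"
    if "u = r * s" "h \<in> Arr (Hom A r z w)" "g \<in> Arr (Hom A s y z)" "f \<in> Arr (Hom A t x y)" for u r s t h g f
    using assoc_arr[OF X] that by simp
  show "v_comp ((VHom (vcat_of A) z w \<otimes>\<^sub>V VHom (vcat_of A) y z) \<otimes>\<^sub>V VHom (vcat_of A) x y) (VComp (vcat_of A) x y w)
        (tensor_mor (VHom (vcat_of A) z w \<otimes>\<^sub>V VHom (vcat_of A) y z) (VHom (vcat_of A) x y)
          (VComp (vcat_of A) y z w) (v_id (VHom (vcat_of A) x y)))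
      = v_comp ((VHom (vcat_of A) z w \<otimes>\<^sub>V VHom (vcat_of A) y z) \<otimes>\<^sub>V VHom (vcat_of A) x y) (VComp (vcat_of A) x z w)
          (v_comp ((VHom (vcat_of A) z w \<otimes>\<^sub>V VHom (vcat_of A) y z) \<otimes>\<^sub>V VHom (vcat_of A) x y)
            (tensor_mor (VHom (vcat_of A) z w) (VHom (vcat_of A) y z \<otimes>\<^sub>V VHom (vcat_of A) x y)
              (v_id (VHom (vcat_of A) z w)) (VComp (vcat_of A) x y z))
            (v_assoc (VHom (vcat_of A) z w) (VHom (vcat_of A) y z) (VHom (vcat_of A) x y)))" (is "?l = ?r")
  proof
    fix s show "?l s = ?r s"
      unfolding v_comp_def fun_comp_def
      by (cases s; intro mk_fun_cong)
        (auto simp: vcat_of_def v_assoc_def tensor_carrier Plus_iff tensor_mor_simps vcat_comp_simps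
          mk_fun_def v_id_def id_fun_def O M aO aM X
          simp del: tensor.simps tensor_mor.simps vcat_comp.simps)
  qed
qed

end

theory Submission
  imports Defs
begin

text \<open>
  Functors out of the empty category carry no information and functors out of the terminal
  category are points, so \<open>hom_r dual_unit C\<close> is isomorphic to C with its two signs
  exchanged.  Under this isomorphism \<open>\<phi> y\<close> corresponds to a sign-reversing map
  \<open>\<psi> : Hom A s c y \<rightarrow> Hom A (Neg * s) x y\<close>, and V-naturality of \<open>\<phi>\<close> becomes
  \<open>\<psi> (g \<circ> f) = g \<circ> \<psi> f\<close>.  By the Yoneda argument such a \<open>\<psi>\<close> is
  precomposition with \<open>\<psi> 1\<^sub>c\<close>, an object of \<open>Hom A Neg x c\<close>; conversely precomposition
  with any 1-cell is natural by associativity.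
\<close>

section \<open>Functors\<close>

lemma mk_fun_apply:
  "a \<in> Obj C \<Longrightarrow> ObjMap (mk_fun C f g) a = f a"
  "h \<in> Arr C \<Longrightarrow> ArrMap (mk_fun C f g) h = g h"
  by (simp_all add: mk_fun_def)

text \<open>\<open>mk_fun\<close> erases all values outside the carriers, so later equations of
  functors reduce to equations between elements.\<close>

lemma mk_fun_eq_iff:
  "mk_fun C f g = mk_fun C f' g' \<longleftrightarrow>
    (\<forall>a\<in>Obj C. f a = f' a) \<and> (\<forall>h\<in>Arr C. g h = g' h)"
  unfolding mk_fun_def by (auto simp: restrict_def fun_eq_iff)

text \<open>This is extensionality of the two maps; it brings an arbitrary functor into the form
  that \<open>mk_fun_eq_iff\<close> compares.\<close>

lemma functor_eq_mk_fun: "cat_functor C D F \<Longrightarrow> F = mk_fun C (ObjMap F) (ArrMap F)"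
  by (cases F)
    (auto simp: mk_fun_def extensional_restrict dest: cat_functor.obj_ext cat_functor.arr_ext)

lemma fun_comp_apply:
  "a \<in> Obj C \<Longrightarrow> ObjMap (fun_comp C G F) a = ObjMap G (ObjMap F a)"
  "h \<in> Arr C \<Longrightarrow> ArrMap (fun_comp C G F) h = ArrMap G (ArrMap F h)"
  by (simp_all add: fun_comp_def mk_fun_apply)

lemma functor_mk_funI:
  assumes "category C" "category D"
    and "\<And>a. a \<in> Obj C \<Longrightarrow> fo a \<in> Obj D"
    and "\<And>f. f \<in> Arr C \<Longrightarrow> fa f \<in> Arr D \<and> Dom D (fa f) = fo (Dom C f) \<and> Cod D (fa f) = fo (Cod C f)"
    and "\<And>a. a \<in> Obj C \<Longrightarrow> fa (Id C a) = Id D (fo a)"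
    and "\<And>f g. \<lbrakk>f \<in> Arr C; g \<in> Arr C; Cod C f = Dom C g\<rbrakk> \<Longrightarrow> fa (Comp C g f) = Comp D (fa g) (fa f)"
  shows "cat_functor C D (mk_fun C fo fa)"
  using assms
  by (simp add: cat_functor_def cat_functor_axioms_def mk_fun_def category_laws[OF assms(1)])

lemma functor_category:
  "cat_functor C D F \<Longrightarrow> category C" "cat_functor C D F \<Longrightarrow> category D"
  by (simp_all add: cat_functor_def)

lemma functor_id: "category C \<Longrightarrow> cat_functor C C (id_fun C)"
  unfolding id_fun_def by (rule functor_mk_funI) simp_all

lemma functor_comp:
  assumes F: "cat_functor C D F" and G: "cat_functor D E G"
  shows "cat_functor C E (fun_comp C G F)"
  unfolding fun_comp_def
  by (rule functor_mk_funI)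
    (simp_all add: functor_category[OF F] functor_category[OF G] functor_laws[OF F] functor_laws[OF G])

lemma fun_comp_id_left: "cat_functor C D F \<Longrightarrow> fun_comp C (id_fun D) F = F"
  by (subst (2) functor_eq_mk_fun)
    (auto simp: fun_comp_def mk_fun_eq_iff id_fun_def mk_fun_apply functor_laws)

lemma fun_comp_assoc:
  "cat_functor C D F \<Longrightarrow> fun_comp C H (fun_comp C G F) = fun_comp C (fun_comp D H G) F"
  by (auto simp: fun_comp_def mk_fun_eq_iff mk_fun_apply functor_laws)

lemma cat_iso_functor: "cat_iso C D F \<Longrightarrow> cat_functor C D F"
  by (simp add: cat_iso_def)

lemma cat_iso_comp:
  assumes "cat_iso C D F" "cat_iso D E G"
  shows "cat_iso C E (fun_comp C G F)"
proof -
  from assms obtain F' G' where F: "cat_functor C D F" "cat_functor D C F'"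
      "fun_comp C F' F = id_fun C" "fun_comp D F F' = id_fun D"
    and G: "cat_functor D E G" "cat_functor E D G'"
      "fun_comp D G' G = id_fun D" "fun_comp E G G' = id_fun E"
    unfolding cat_iso_def by auto
  have "fun_comp C (fun_comp E F' G') (fun_comp C G F) = id_fun C"
    using fun_comp_assoc[OF functor_comp[OF F(1) G(1)], of F' G'] fun_comp_assoc[OF F(1), of G' G]
    by (simp add: F G fun_comp_id_left[OF F(1)])
  moreover have "fun_comp E (fun_comp C G F) (fun_comp E F' G') = id_fun E"
    using fun_comp_assoc[OF functor_comp[OF G(2) F(2)], of G F] fun_comp_assoc[OF G(2), of F F']
    by (simp add: F G fun_comp_id_left[OF G(2)])
  ultimately show ?thesis
    unfolding cat_iso_def using functor_comp[OF F(1) G(1)] functor_comp[OF G(2) F(2)] by blast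
qed

section \<open>Products, opposites and coproducts\<close>

lemma category_prod: "category C \<Longrightarrow> category D \<Longrightarrow> category (C \<times>\<^sub>C D)"
  by (rule category.intro) (auto simp: prod_cat_def category_laws)

lemma functor_op: "cat_functor C D F \<Longrightarrow> cat_functor (op_cat C) (op_cat D) F"
  by (simp add: cat_functor_def cat_functor_axioms_def category_op) (auto simp: op_cat_def)

lemma functor_prod:
  assumes F: "cat_functor C C' F" and G: "cat_functor D D' G"
  shows "cat_functor (C \<times>\<^sub>C D) (C' \<times>\<^sub>C D') (prod_fun C D F G)"
  unfolding prod_fun_def
  by (intro functor_mk_funI category_prod functor_category[OF F] functor_category[OF G])
    (auto simp: prod_cat_def functor_laws[OF F] functor_laws[OF G])

lemma functor_coprod:
  assumes F: "cat_functor C C' F" and G: "cat_functor D D' G"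
  shows "cat_functor (C +\<^sub>C D) (C' +\<^sub>C D') (coprod_fun C D F G)"
  unfolding coprod_fun_def
  by (intro functor_mk_funI category_coprod functor_category[OF F] functor_category[OF G])
    (auto simp: coprod_cat_def functor_laws[OF F] functor_laws[OF G])

text \<open>The laws are inherited componentwise from D. The identity laws also use that
  \<open>NMap\<close> is extensional, because composites are restricted to
  \<open>Obj C\<close>.\<close>

lemma category_fun:
  assumes C: "category C" and D: "category D"
  shows "category (fun_cat C D)"
proof -
  note laws = category_laws[OF C] category_laws[OF D]
  have id: "nat_trans C D \<lparr>NDom = F, NCod = F, NMap = (\<lambda>a\<in>Obj C. Id D (ObjMap F a))\<rparr>"
    if F: "cat_functor C D F" for F
    using F
    by (auto simp: nat_trans_def laws functor_laws[OF F])
      (metis F category.comp_id_left[OF D] category.comp_id_right[OF D] functor_laws(2-4))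
  have comp: "nat_trans C D \<lparr>NDom = NDom \<eta>, NCod = NCod \<theta>,
      NMap = (\<lambda>a\<in>Obj C. Comp D (NMap \<theta> a) (NMap \<eta> a))\<rparr>"
    if n: "nat_trans C D \<eta>" "nat_trans C D \<theta>" "NCod \<eta> = NDom \<theta>" for \<eta> \<theta>
  proof -
    interpret \<eta>: nat_trans C D \<eta> by fact
    interpret \<theta>: nat_trans C D \<theta> by fact
    note F = functor_laws[OF \<eta>.source_functor] functor_laws[OF \<theta>.source_functor]
      functor_laws[OF \<theta>.target_functor]
    note N = \<eta>.component_arr \<eta>.component_dom \<eta>.component_cod
      \<theta>.component_arr \<theta>.component_dom \<theta>.component_cod
    \<comment> \<open>The naturality squares of \<eta> and \<theta> are pasted along
      \<open>ArrMap (NDom \<theta>) f\<close>, their common edge by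
      \<open>NCod \<eta> = NDom \<theta>\<close>.\<close>
    have nat: "Comp D (Comp D (NMap \<theta> (Cod C f)) (NMap \<eta> (Cod C f))) (ArrMap (NDom \<eta>) f) =
        Comp D (ArrMap (NCod \<theta>) f) (Comp D (NMap \<theta> (Dom C f)) (NMap \<eta> (Dom C f)))"
      if f: "f \<in> Arr C" for f
    proof -
      have "Comp D (Comp D (NMap \<theta> (Cod C f)) (NMap \<eta> (Cod C f))) (ArrMap (NDom \<eta>) f) =
          Comp D (NMap \<theta> (Cod C f)) (Comp D (NMap \<eta> (Cod C f)) (ArrMap (NDom \<eta>) f))"
        using f n(3) by (simp add: category.comp_assoc[OF D] laws F N)
      also have "\<dots> = Comp D (NMap \<theta> (Cod C f)) (Comp D (ArrMap (NDom \<theta>) f) (NMap \<eta> (Dom C f)))"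
        using f n(3) by (simp add: \<eta>.naturality)
      also have "\<dots> = Comp D (Comp D (NMap \<theta> (Cod C f)) (ArrMap (NDom \<theta>) f)) (NMap \<eta> (Dom C f))"
        using f n(3) by (simp add: category.comp_assoc[OF D] laws F N)
      also have "\<dots> = Comp D (Comp D (ArrMap (NCod \<theta>) f) (NMap \<theta> (Dom C f))) (NMap \<eta> (Dom C f))"
        using f by (simp add: \<theta>.naturality)
      also have "\<dots> = Comp D (ArrMap (NCod \<theta>) f) (Comp D (NMap \<theta> (Dom C f)) (NMap \<eta> (Dom C f)))"
        using f n(3) by (simp add: category.comp_assoc[OF D] laws F N)
      finally show ?thesis .
    qed
    show ?thesis
      using n(3) by (auto simp: nat_trans_def \<eta>.source_functor \<theta>.target_functor laws N nat)
  qed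
  have ext: "\<eta> = \<theta>" if "NDom \<eta> = NDom \<theta>" "NCod \<eta> = NCod \<theta>" "NMap \<eta> = NMap \<theta>"
    for \<eta> \<theta> :: "('a, 'b, 'c, 'd) ntrans"
    using that by (cases \<eta>; cases \<theta>) simp
  show ?thesis
  proof (rule category.intro)
    fix \<eta> assume "\<eta> \<in> Arr (fun_cat C D)"
    then interpret \<eta>: nat_trans C D \<eta> by (simp add: fun_cat_def)
    show "Comp (fun_cat C D) (Id (fun_cat C D) (Cod (fun_cat C D) \<eta>)) \<eta> = \<eta>"
      by (rule ext) (auto simp: fun_cat_def fun_eq_iff restrict_def
        extensional_arb[OF \<eta>.component_ext] category.comp_id_left[OF D] \<eta>.component_arr
        simp flip: \<eta>.component_cod)
    show "Comp (fun_cat C D) \<eta> (Id (fun_cat C D) (Dom (fun_cat C D) \<eta>)) = \<eta>"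
      by (rule ext) (auto simp: fun_cat_def fun_eq_iff restrict_def
        extensional_arb[OF \<eta>.component_ext] category.comp_id_right[OF D] \<eta>.component_arr
        simp flip: \<eta>.component_dom)
  next
    fix \<eta> \<theta> \<kappa>
    assume "\<eta> \<in> Arr (fun_cat C D)" "\<theta> \<in> Arr (fun_cat C D)" "\<kappa> \<in> Arr (fun_cat C D)"
      "Cod (fun_cat C D) \<eta> = Dom (fun_cat C D) \<theta>" "Cod (fun_cat C D) \<theta> = Dom (fun_cat C D) \<kappa>"
    then show "Comp (fun_cat C D) (Comp (fun_cat C D) \<kappa> \<theta>) \<eta> =
        Comp (fun_cat C D) \<kappa> (Comp (fun_cat C D) \<theta> \<eta>)"
      by (auto simp: fun_cat_def restrict_def fun_eq_iff category.comp_assoc[OF D]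
        nat_trans.component_arr nat_trans.component_dom nat_trans.component_cod)
  qed (auto simp: fun_cat_def id comp nat_trans.source_functor nat_trans.target_functor)
qed

section \<open>Homs out of the dual unit\<close>

type_synonym ('p, 'n) dual_hom_obj = "(unit, unit, 'p, 'n) fctr \<times> (unit, unit, 'p, 'n) fctr"
type_synonym ('p, 'n) dual_hom_arr = "(unit, unit, 'p, 'n) ntrans \<times> (unit, unit, 'p, 'n) ntrans"

abbreviation dual_hom ::
    "('p, 'n) cat \<Rightarrow> ('p, 'n) cat \<Rightarrow> (('p, 'n) dual_hom_obj, ('p, 'n) dual_hom_arr) cat" where
  "dual_hom C D \<equiv> fun_cat empty_cat C \<times>\<^sub>C fun_cat terminal_cat D"

text \<open>This is the second projection followed by evaluation at the object of
  \<open>terminal_cat\<close>; it identifies \<open>dual_hom C D\<close> with D, and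
  \<open>const_point\<close> is the inverse.\<close>

definition eval_point where
  "eval_point C D = mk_fun (dual_hom C D) (\<lambda>F. ObjMap (snd F) ()) (\<lambda>\<eta>. NMap (snd \<eta>) ())"

text \<open>The first components below are the unique functor, and its identity, out of the empty
  category; \<^const>\<open>undefined\<close> keeps them extensional.\<close>

definition const_obj :: "('p, 'n) cat \<Rightarrow> 'p \<Rightarrow> ('p, 'n) dual_hom_obj" where
  "const_obj D d = (mk_fun empty_cat undefined undefined,
    mk_fun terminal_cat (\<lambda>_. d) (\<lambda>_. Id D d))"

definition const_arr :: "('p, 'n) cat \<Rightarrow> 'n \<Rightarrow> ('p, 'n) dual_hom_arr" where
  "const_arr D f =
    (\<lparr>NDom = fst (const_obj D (Dom D f)), NCod = fst (const_obj D (Cod D f)), NMap = (\<lambda>_. undefined)\<rparr>,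
     \<lparr>NDom = snd (const_obj D (Dom D f)), NCod = snd (const_obj D (Cod D f)), NMap = (\<lambda>_. f)\<rparr>)"

text \<open>A functor out of \<open>empty_cat\<close> takes no values, so one formula inverts
  \<open>eval_point C D\<close> for every category C.\<close>

definition const_point where
  "const_point D = mk_fun D (const_obj D) (const_arr D)"

section \<open>The isomorphism between \<open>dual_hom C D\<close> and D\<close>

lemma op_dual_unit: "op_cat empty_cat = empty_cat" "op_cat terminal_cat = terminal_cat"
  by (simp_all add: op_cat_def empty_cat_def terminal_cat_def)

text \<open>The opposites in the negative part of \<open>hom_r\<close> disappear by
  \<open>op_dual_unit\<close>, so the two signs differ only in which category of C is paired with
  the terminal category.\<close>

lemma hom_r_dual_unit: "hom_r dual_unit C s = dual_hom (C s) (C (Neg * s))"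
  by (cases s) (simp_all add: op_dual_unit)

lemma category_dual_hom: "category C \<Longrightarrow> category D \<Longrightarrow> category (dual_hom C D)"
  by (intro category_prod category_fun category_empty category_terminal)

text \<open>With empty carriers, extensionality forces both maps to be \<open>undefined\<close>
  everywhere.\<close>

lemma empty_cat_functor_iff:
  "category C \<Longrightarrow> cat_functor empty_cat C F \<longleftrightarrow> F = mk_fun empty_cat undefined undefined"
  by (cases F) (auto simp: cat_functor_def cat_functor_axioms_def category_empty[unfolded empty_cat_def]
      mk_fun_def empty_cat_def extensional_def restrict_def)

text \<open>The carriers are all of \<open>unit\<close>, so extensionality is automatic, and
  preservation of composites amounts to \<open>comp_id_id\<close>.\<close>

lemma terminal_cat_functor_iff:
  assumes "category D"
  shows "cat_functor terminal_cat D F \<longleftrightarrow>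
    ObjMap F () \<in> Obj D \<and> ArrMap F () = Id D (ObjMap F ())"
  using assms
  by (auto simp: cat_functor_def cat_functor_axioms_def category_terminal[unfolded terminal_cat_def]
      category_laws terminal_cat_def comp_id_id)

lemma functor_const_obj:
  assumes "category C" "category D" "d \<in> Obj D"
  shows "cat_functor empty_cat C (fst (const_obj D d))"
    "cat_functor terminal_cat D (snd (const_obj D d))"
  using assms
  by (simp_all add: const_obj_def empty_cat_functor_iff terminal_cat_functor_iff)
    (simp_all add: mk_fun_def terminal_cat_def)

lemma functor_eval_point:
  assumes C: "category C" and D: "category D"
  shows "cat_functor (dual_hom C D) D (eval_point C D)"
  unfolding eval_point_def
  by (intro functor_mk_funI category_dual_hom C D)
    (auto simp: prod_cat_def fun_cat_def terminal_cat_def functor_laws nat_trans.component_arr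
      nat_trans.component_dom nat_trans.component_cod)

lemma functor_const_point:
  assumes C: "category C" and D: "category D"
  shows "cat_functor D (dual_hom C D) (const_point D)"
proof -
  note laws = category_laws[OF D]
  \<comment> \<open>Naturality is vacuous over the empty category; over the terminal one it says
    that composing f with an identity on either side gives the same arrow.\<close>
  have "nat_trans empty_cat C (fst (const_arr D f))" "nat_trans terminal_cat D (snd (const_arr D f))"
    if "f \<in> Arr D" for f
    using that functor_const_obj[OF C D]
    by (auto simp: nat_trans_def laws const_arr_def)
      (auto simp: const_obj_def mk_fun_def empty_cat_def terminal_cat_def laws)
  then show ?thesis
    unfolding const_point_def using functor_const_obj[OF C D]
    by (intro functor_mk_funI category_dual_hom C D)
      (auto simp: prod_cat_def fun_cat_def mem_Times_iff laws,
       auto simp: laws const_obj_def const_arr_def mk_fun_def empty_cat_def terminal_cat_def restrict_def)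
qed

lemma eval_const_point:
  assumes C: "category C" and D: "category D"
  shows "fun_comp D (eval_point C D) (const_point D) = id_fun D"
  using functor_laws(1,2)[OF functor_const_point[OF C D]]
  by (auto simp: fun_comp_def id_fun_def mk_fun_eq_iff mk_fun_apply eval_point_def const_point_def)
    (auto simp: const_obj_def const_arr_def mk_fun_def terminal_cat_def)

text \<open>\<open>eval_point\<close> forgets the first coordinate; uniqueness of functors and
  transformations out of \<open>empty_cat\<close> restores it.\<close>

lemma const_eval_point:
  assumes C: "category C" and D: "category D"
  shows "fun_comp (dual_hom C D) (const_point D) (eval_point C D) = id_fun (dual_hom C D)"
proof -
  have obj: "const_obj D (ObjMap G ()) = (F, G)"
    if "cat_functor empty_cat C F" "cat_functor terminal_cat D G" for F G
    using that C D
    by (cases G) (simp add: const_obj_def empty_cat_functor_iff[OF C] terminal_cat_functor_iff[OF D],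
      auto simp: mk_fun_def terminal_cat_def restrict_def)
  have arr: "const_arr D (NMap \<theta> ()) = (\<eta>, \<theta>)"
    if n: "nat_trans empty_cat C \<eta>" "nat_trans terminal_cat D \<theta>" for \<eta> \<theta>
  proof -
    interpret \<eta>: nat_trans empty_cat C \<eta> by fact
    interpret \<theta>: nat_trans terminal_cat D \<theta> by fact
    \<comment> \<open>The domain and codomain of the single component of \<theta> give the values of
      its end functors, from which \<open>obj\<close> recovers the ends of both \<eta> and
      \<theta>.\<close>
    have "Dom D (NMap \<theta> ()) = ObjMap (NDom \<theta>) ()" "Cod D (NMap \<theta> ()) = ObjMap (NCod \<theta>) ()"
      using \<theta>.component_dom \<theta>.component_cod by (simp_all add: terminal_cat_def)
    moreover have "NMap \<eta> = (\<lambda>_. undefined)"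
      using \<eta>.component_ext by (auto simp: empty_cat_def)
    ultimately show ?thesis
      using obj[OF \<eta>.source_functor \<theta>.source_functor] obj[OF \<eta>.target_functor \<theta>.target_functor]
      by (cases \<eta>; cases \<theta>) (auto simp: const_arr_def)
  qed
  show ?thesis
    using functor_laws(1,2)[OF functor_eval_point[OF C D]]
    by (auto simp: fun_comp_def id_fun_def mk_fun_eq_iff mk_fun_apply eval_point_def const_point_def)
      (auto simp: prod_cat_def fun_cat_def obj arr)
qed

lemma iso_eval_point:
  "category C \<Longrightarrow> category D \<Longrightarrow> cat_iso (dual_hom C D) D (eval_point C D)"
  unfolding cat_iso_def
  using functor_eval_point functor_const_point eval_const_point const_eval_point by blast

lemma iso_const_point:
  "category C \<Longrightarrow> category D \<Longrightarrow> cat_iso D (dual_hom C D) (const_point D)"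
  unfolding cat_iso_def
  using functor_eval_point functor_const_point eval_const_point const_eval_point by blast

section \<open>Tensor products, indexed by the sign of the first factor\<close>

text \<open>The summand of \<open>(A \<otimes>\<^sub>V B) s\<close> with first factor in \<open>A r\<close> has its second factor in
  \<open>B (r * s)\<close>; this indexing treats all four sign combinations uniformly.\<close>

fun sum_in :: "sign \<Rightarrow> 'a \<Rightarrow> 'a + 'a" where
  "sum_in Pos a = Inl a"
| "sum_in Neg a = Inr a"

text \<open>The signs form the group of order two; the last rule moves \<open>Neg\<close> to the
  front.\<close>

lemma sign_cancel: "Neg * (Neg * s) = s" "r * (r * s) = s" "r * r = Pos" "r * (Neg * r) = Neg"
    "r * (Neg * s) = Neg * (r * s)" for r s :: sign
  by (cases r; cases s; simp)+

lemma sum_in_tensor_iff: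
  "sum_in r (a, b) \<in> Obj ((A \<otimes>\<^sub>V B) s) \<longleftrightarrow> a \<in> Obj (A r) \<and> b \<in> Obj (B (r * s))"
  "sum_in r (f, g) \<in> Arr ((A \<otimes>\<^sub>V B) s) \<longleftrightarrow> f \<in> Arr (A r) \<and> g \<in> Arr (B (r * s))"
  by (cases r; simp add: tensor_carrier Plus_iff del: tensor.simps)+

text \<open>Taking opposites leaves carriers unchanged, so both summands have the same description
  once the sign r of the first factor is a variable.\<close>

lemma ball_tensor:
  "(\<forall>u\<in>Obj ((A \<otimes>\<^sub>V B) s). P u) \<longleftrightarrow>
    (\<forall>r. \<forall>a\<in>Obj (A r). \<forall>b\<in>Obj (B (r * s)). P (sum_in r (a, b)))"
  "(\<forall>u\<in>Arr ((A \<otimes>\<^sub>V B) s). Q u) \<longleftrightarrow>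
    (\<forall>r. \<forall>f\<in>Arr (A r). \<forall>g\<in>Arr (B (r * s)). Q (sum_in r (f, g)))"
  by (auto simp: tensor_carrier all_sign simp del: tensor.simps)

lemma tensor_mor_sum_in:
  "a \<in> Obj (A r) \<Longrightarrow> b \<in> Obj (B (r * s)) \<Longrightarrow>
    ObjMap (tensor_mor A B F G s) (sum_in r (a, b)) = sum_in r (ObjMap (F r) a, ObjMap (G (r * s)) b)"
  "f \<in> Arr (A r) \<Longrightarrow> g \<in> Arr (B (r * s)) \<Longrightarrow>
    ArrMap (tensor_mor A B F G s) (sum_in r (f, g)) = sum_in r (ArrMap (F r) f, ArrMap (G (r * s)) g)"
  by (cases r; simp add: tensor_mor_simps del: tensor_mor.simps)+

lemma vcat_comp_sum_in:
  "g \<in> Obj (Hom A r y z) \<Longrightarrow> f \<in> Obj (Hom A (r * s) x y) \<Longrightarrow>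
    ObjMap (vcat_comp A x y z s) (sum_in r (g, f)) = ObjMap (CComp A r (r * s) x y z) (g, f)"
  "\<beta> \<in> Arr (Hom A r y z) \<Longrightarrow> \<alpha> \<in> Arr (Hom A (r * s) x y) \<Longrightarrow>
    ArrMap (vcat_comp A x y z s) (sum_in r (\<beta>, \<alpha>)) = ArrMap (CComp A r (r * s) x y z) (\<beta>, \<alpha>)"
  by (cases r; simp add: vcat_comp_simps del: vcat_comp.simps)+

text \<open>If a has sign r and the pair (a, b) has total sign q, then b has sign
  \<open>r * q\<close>, which is the tag of the inner pair on the right.\<close>

lemma assoc_map_sum_in:
  "assoc_map (sum_in q (sum_in r (a, b), c)) = sum_in r (a, sum_in (r * q) (b, c))"
  by (cases q; cases r) simp_all

lemma category_tensor: "v_obj A \<Longrightarrow> v_obj B \<Longrightarrow> v_obj (A \<otimes>\<^sub>V B)"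
  by (simp add: v_obj_def all_sign category_coprod category_prod category_op)

lemma functor_tensor: "v_mor A A' F \<Longrightarrow> v_mor B B' G \<Longrightarrow> v_mor (A \<otimes>\<^sub>V B) (A' \<otimes>\<^sub>V B') (tensor_mor A B F G)"
  by (simp add: v_mor_def all_sign functor_coprod functor_prod functor_op)

text \<open>Exchanging the signs of the second factor exchanges those of the tensor product. This
  lets \<open>A \<otimes>\<^sub>V hom_r dual_unit C\<close> be compared with
  \<open>A \<otimes>\<^sub>V C\<close> in the other sign.\<close>

lemma tensor_shift: "(A \<otimes>\<^sub>V (\<lambda>s. B (Neg * s))) s = (A \<otimes>\<^sub>V B) (Neg * s)"
  by (cases s) simp_all

section \<open>The closed structure at the dual unit\<close>

text \<open>In total sign \<open>Neg * r\<close> the partner of an F of sign r has sign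
  \<open>Neg\<close>, where \<open>dual_unit\<close> is terminal; hence the counit is evaluation at
  the point.\<close>

lemma v_eval_dual_unit:
  assumes F: "F \<in> Obj (hom_r dual_unit C r)"
  shows "ObjMap (v_eval dual_unit C (Neg * r)) (sum_in r (F, ())) = ObjMap (snd F) ()"
  using F
  by (cases F; cases r)
    (auto simp: copair_fun_def fun_comp_def eval_fun_def prod_fun_def fst_fun_def snd_fun_def
      id_fun_def mk_fun_def coprod_cat_def prod_cat_def op_dual_unit Plus_iff terminal_cat_def op_cat_def)

lemma v_eval_dual_unit_arr:
  assumes C: "v_obj C" and \<eta>: "\<eta> \<in> Arr (hom_r dual_unit C r)"
  shows "ArrMap (v_eval dual_unit C (Neg * r)) (sum_in r (\<eta>, ())) = NMap (snd \<eta>) ()"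
proof -
  let ?D = "C (Neg * r)" and ?\<theta> = "snd \<eta>"
  have D: "category ?D" using C by (simp add: v_obj_def)
  have "?\<theta> \<in> Arr (fun_cat terminal_cat ?D)"
    using \<eta> unfolding hom_r_dual_unit by (auto simp: prod_cat_def)
  then interpret nat_trans terminal_cat ?D ?\<theta> by (simp add: fun_cat_def)
  \<comment> \<open>\<open>eval_fun\<close> composes the component with the image of the only arrow
    of \<open>terminal_cat\<close>, which is an identity.\<close>
  have "Comp ?D (NMap ?\<theta> ()) (ArrMap (NDom ?\<theta>) ()) = NMap ?\<theta> ()"
    using category.comp_id_right[OF D component_arr, of "()"] source_functor component_dom[of "()"]
    by (simp add: terminal_cat_functor_iff[OF D]) (simp add: terminal_cat_def)
  then show ?thesis
    using \<eta>
    by (cases \<eta>; cases r)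
      (auto simp: copair_fun_def fun_comp_def eval_fun_def prod_fun_def fst_fun_def snd_fun_def
        id_fun_def mk_fun_def coprod_cat_def prod_cat_def op_dual_unit Plus_iff terminal_cat_def op_cat_def)
qed

text \<open>L may be arbitrary because its transpose takes values in functors out of
  \<open>empty_cat\<close>. The transpose of K at m is the point \<open>ObjMap G m\<close>, as G
  preserves identities.\<close>

lemma curry_point:
  assumes G: "cat_functor M D G"
    and obj: "\<And>m. m \<in> Obj M \<Longrightarrow> ObjMap K (m, ()) = ObjMap G m"
    and arr: "\<And>f. f \<in> Arr M \<Longrightarrow> ArrMap K (f, ()) = ArrMap G f"
  shows "pair_fun M (curry_fun M empty_cat L) (curry_fun M terminal_cat K) =
    fun_comp M (const_point D) G"
proof -
  note laws = functor_laws[OF G] category_laws[OF functor_category(1)[OF G]]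
  have e: "mk_fun empty_cat fo fa = mk_fun empty_cat undefined undefined" for fo fa
    by (simp add: mk_fun_def empty_cat_def restrict_def)
  have L: "curry_obj M empty_cat L m = fst (const_obj D (ObjMap G m))" for m
    unfolding curry_obj_def by (subst e) (simp add: const_obj_def)
  have K: "curry_obj M terminal_cat K m = snd (const_obj D (ObjMap G m))" if "m \<in> Obj M" for m
    using that by (simp add: curry_obj_def const_obj_def mk_fun_eq_iff obj arr laws)
  show ?thesis
    unfolding pair_fun_def fun_comp_def mk_fun_eq_iff
    by (auto simp: curry_fun_def mk_fun_apply const_point_def laws K L const_arr_def)
      (auto simp: empty_cat_def terminal_cat_def restrict_def arr)
qed

text \<open>This computes all transposes along the dual unit: H matters only on the pairs
  \<open>(m, ())\<close>, which lie in sign \<open>Neg * s\<close> when m has sign s.\<close>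

lemma v_curry_dual_unit:
  assumes G: "cat_functor (M s) D G"
    and obj: "\<And>m. m \<in> Obj (M s) \<Longrightarrow> ObjMap (H (Neg * s)) (sum_in s (m, ())) = ObjMap G m"
    and arr: "\<And>f. f \<in> Arr (M s) \<Longrightarrow> ArrMap (H (Neg * s)) (sum_in s (f, ())) = ArrMap G f"
  shows "v_curry M dual_unit H s = fun_comp (M s) (const_point D) G"
proof (cases s)
  case Pos
  then show ?thesis
    using assms unfolding Pos v_curry.simps dual_unit.simps op_dual_unit
    by (intro curry_point)
      (auto simp: fun_comp_def inl_fun_def mk_fun_def prod_cat_def terminal_cat_def)
next
  case Neg
  then show ?thesis
    using assms unfolding Neg v_curry.simps dual_unit.simps op_dual_unit
    by (intro curry_point)
      (auto simp: fun_comp_def inr_fun_def mk_fun_def prod_cat_def terminal_cat_def)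
qed

lemma terminal_cat_carrier: "a \<in> Obj terminal_cat" "f \<in> Arr terminal_cat"
  by (simp_all add: terminal_cat_def)

lemma sum_in_tensor_dual_unit_iff:
  "sum_in r (a, ()) \<in> Obj ((M \<otimes>\<^sub>V dual_unit) (Neg * r)) \<longleftrightarrow> a \<in> Obj (M r)"
  "sum_in r (f, ()) \<in> Arr ((M \<otimes>\<^sub>V dual_unit) (Neg * r)) \<longleftrightarrow> f \<in> Arr (M r)"
  by (simp_all only: sum_in_tensor_iff sign_cancel dual_unit.simps terminal_cat_carrier simp_thms)

text \<open>The counit is evaluation at the point, so the action on F is F in the opposite sign,
  conjugated by the isomorphisms with \<open>dual_hom\<close>.\<close>

lemma hom_r_mor_dual_unit:
  assumes C: "v_obj C" and F: "v_mor C D F"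
  shows "hom_r_mor dual_unit C F s =
    fun_comp (hom_r dual_unit C s) (const_point (D (Neg * s)))
      (fun_comp (hom_r dual_unit C s) (F (Neg * s)) (eval_point (C s) (C (Neg * s))))"
proof -
  let ?M = "hom_r dual_unit C"
  have "cat_functor (?M s) (C (Neg * s)) (eval_point (C s) (C (Neg * s)))"
    using C by (simp add: v_obj_def hom_r_dual_unit functor_eval_point del: hom_r.simps)
  moreover have "cat_functor (C (Neg * s)) (D (Neg * s)) (F (Neg * s))"
    using F by (simp add: v_mor_def)
  ultimately have G: "cat_functor (?M s) (D (Neg * s))
      (fun_comp (?M s) (F (Neg * s)) (eval_point (C s) (C (Neg * s))))"
    by (rule functor_comp)
  have eval: "m \<in> Obj (?M s) \<Longrightarrow> ObjMap (eval_point (C s) (C (Neg * s))) m = ObjMap (snd m) ()"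
    "n \<in> Arr (?M s) \<Longrightarrow> ArrMap (eval_point (C s) (C (Neg * s))) n = NMap (snd n) ()" for m n
    by (simp_all add: eval_point_def mk_fun_apply hom_r_dual_unit del: hom_r.simps)
  show ?thesis
    unfolding hom_r_mor_def
    by (rule v_curry_dual_unit[where M = ?M, OF G])
      (simp_all add: v_comp_def fun_comp_apply sum_in_tensor_dual_unit_iff v_eval_dual_unit
        v_eval_dual_unit_arr C eval del: hom_r.simps tensor.simps v_eval.simps)
qed

text \<open>The associator moves the point next to the second factor, where the counit evaluates. Up
  to the point isomorphisms the canonical morphism is thus the identity, with the sign shift of
  \<open>tensor_shift\<close>.\<close>

lemma tensor_hom_r_dual_unit:
  assumes A: "v_obj A" and C: "v_obj C"
  shows "tensor_hom_r A dual_unit C s =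
    fun_comp ((A \<otimes>\<^sub>V hom_r dual_unit C) s) (const_point ((A \<otimes>\<^sub>V C) (Neg * s)))
      (tensor_mor A (hom_r dual_unit C) (v_id A) (\<lambda>s. eval_point (C s) (C (Neg * s))) s)"
proof -
  let ?H = "hom_r dual_unit C"
  let ?M = "A \<otimes>\<^sub>V ?H" and ?E = "\<lambda>s. eval_point (C s) (C (Neg * s))"
  have "v_mor ?H (\<lambda>s. C (Neg * s)) ?E"
    using C by (simp add: v_obj_def v_mor_def hom_r_dual_unit functor_eval_point del: hom_r.simps)
  moreover have "v_mor A A (v_id A)"
    using A by (simp add: v_mor_def v_obj_def v_id_def functor_id)
  ultimately have "v_mor ?M (A \<otimes>\<^sub>V (\<lambda>s. C (Neg * s))) (tensor_mor A ?H (v_id A) ?E)"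
    by (intro functor_tensor)
  then have G: "cat_functor (?M s) ((A \<otimes>\<^sub>V C) (Neg * s)) (tensor_mor A ?H (v_id A) ?E s)"
    unfolding v_mor_def tensor_shift by blast
  let ?K = "v_comp (?M \<otimes>\<^sub>V dual_unit) (tensor_mor A (?H \<otimes>\<^sub>V dual_unit) (v_id A) (v_eval dual_unit C))
        (v_assoc A ?H dual_unit) (Neg * s)"
  have obj: "ObjMap ?K (sum_in s (sum_in r (a, h), ())) = ObjMap (tensor_mor A ?H (v_id A) ?E s) (sum_in r (a, h))"
    if "a \<in> Obj (A r)" "h \<in> Obj (?H (r * s))" for r a h
    using that
    by (simp add: v_comp_def fun_comp_apply sum_in_tensor_iff terminal_cat_carrier v_assoc_def
        mk_fun_apply assoc_map_sum_in tensor_mor_sum_in sign_cancel v_eval_dual_unit eval_point_def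
        hom_r_dual_unit[of C "r * s", symmetric] mult.commute[of s r]
        del: tensor.simps hom_r.simps tensor_mor.simps v_eval.simps)
  have arr: "ArrMap ?K (sum_in s (sum_in r (a, h), ())) = ArrMap (tensor_mor A ?H (v_id A) ?E s) (sum_in r (a, h))"
    if "a \<in> Arr (A r)" "h \<in> Arr (?H (r * s))" for r a h
    using that
    by (simp add: v_comp_def fun_comp_apply sum_in_tensor_iff terminal_cat_carrier v_assoc_def
        mk_fun_apply assoc_map_sum_in tensor_mor_sum_in sign_cancel v_eval_dual_unit_arr C eval_point_def
        hom_r_dual_unit[of C "r * s", symmetric] mult.commute[of s r]
        del: tensor.simps hom_r.simps tensor_mor.simps v_eval.simps)
  have "\<forall>m\<in>Obj (?M s). ObjMap ?K (sum_in s (m, ())) = ObjMap (tensor_mor A ?H (v_id A) ?E s) m"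
    "\<forall>n\<in>Arr (?M s). ArrMap ?K (sum_in s (n, ())) = ArrMap (tensor_mor A ?H (v_id A) ?E s) n"
    unfolding ball_tensor using obj arr by blast+
  then show ?thesis
    unfolding tensor_hom_r_def by (intro v_curry_dual_unit[where M = ?M, OF G]) blast+
qed

section \<open>Copowers by the dual unit\<close>

text \<open>An inverse can be chosen in each sign separately.\<close>

lemma v_iso_iff: "v_iso A B F \<longleftrightarrow> (\<forall>s. cat_iso (A s) (B s) (F s))"
proof
  assume "v_iso A B F"
  then show "\<forall>s. cat_iso (A s) (B s) (F s)"
    unfolding v_iso_def cat_iso_def v_mor_def v_comp_def v_id_def fun_eq_iff by blast
next
  assume iso: "\<forall>s. cat_iso (A s) (B s) (F s)"
  then obtain G where "\<forall>s. cat_functor (B s) (A s) (G s) \<and>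
      fun_comp (A s) (G s) (F s) = id_fun (A s) \<and> fun_comp (B s) (F s) (G s) = id_fun (B s)"
    unfolding cat_iso_def by metis
  with iso show "v_iso A B F"
    unfolding v_iso_def cat_iso_def v_mor_def v_comp_def v_id_def fun_eq_iff by blast
qed

text \<open>For fixed r, multiplication by r is an involution, so \<open>r * s\<close> can replace s
  as the parameter.\<close>

lemma sign_reindex: "(\<forall>s r. Q s r (r * s)) \<longleftrightarrow> (\<forall>r t. Q (r * t) r t)" for Q :: "sign \<Rightarrow> sign \<Rightarrow> sign \<Rightarrow> bool"
proof (intro iffI allI)
  fix r t assume "\<forall>s r. Q s r (r * s)"
  then have "Q (r * t) r (r * (r * t))" by blast
  then show "Q (r * t) r t" by (simp only: sign_cancel)
next
  fix s r assume "\<forall>r t. Q (r * t) r t"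
  then have "Q (r * (r * s)) r (r * s)" by blast
  then show "Q s r (r * s)" by (simp only: sign_cancel)
qed

lemma eval_const_point_apply:
  assumes "category C" "category D"
  shows "d \<in> Obj D \<Longrightarrow> ObjMap (eval_point C D) (ObjMap (const_point D) d) = d"
    "f \<in> Arr D \<Longrightarrow> ArrMap (eval_point C D) (ArrMap (const_point D) f) = f"
  using eval_const_point[OF assms] by (auto simp: fun_comp_def id_fun_def mk_fun_eq_iff)

lemma const_eval_point_apply:
  assumes "category C" "category D"
  shows "F \<in> Obj (dual_hom C D) \<Longrightarrow> ObjMap (const_point D) (ObjMap (eval_point C D) F) = F"
    "\<eta> \<in> Arr (dual_hom C D) \<Longrightarrow> ArrMap (const_point D) (ArrMap (eval_point C D) \<eta>) = \<eta>"
  using const_eval_point[OF assms] by (auto simp: fun_comp_def id_fun_def mk_fun_eq_iff)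

context contravariance_2category
begin

lemma comp_carrier:
  assumes "x \<in> Ob A" "y \<in> Ob A" "z \<in> Ob A"
  shows "g \<in> Obj (Hom A s y z) \<Longrightarrow> f \<in> Obj (Hom A t x y) \<Longrightarrow>
      ObjMap (CComp A s t x y z) (g, f) \<in> Obj (Hom A (s * t) x z)"
    "\<beta> \<in> Arr (Hom A s y z) \<Longrightarrow> \<alpha> \<in> Arr (Hom A t x y) \<Longrightarrow>
      ArrMap (CComp A s t x y z) (\<beta>, \<alpha>) \<in> Arr (Hom A (s * t) x z)"
  using functor_laws(1)[OF comp_functor[OF assms], of "(g, f)" s t]
    functor_laws(2)[OF comp_functor[OF assms], of "(\<beta>, \<alpha>)" s t]
  by (cases s; simp add: prod_cat_def op_cat_def)+

text \<open>Since \<open>const_point\<close> inverts \<open>eval_point\<close>, \<phi> is \<psi>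
  followed by \<open>const_point\<close>. On a pair (g, f) both sides of V-naturality are then
  values of \<open>const_point\<close>, which is injective and can be cancelled.\<close>

lemma copower_naturality_iff:
  assumes X: "x \<in> Ob A" "c \<in> Ob A" "y \<in> Ob A" "z \<in> Ob A"
    and \<phi>: "\<And>s y. y \<in> Ob A \<Longrightarrow>
      cat_functor (Hom A s c y) (dual_hom (Hom A s x y) (Hom A (Neg * s) x y)) (\<phi> y s)"
    and \<psi>: "\<And>s y. y \<in> Ob A \<Longrightarrow>
      \<psi> y s = fun_comp (Hom A s c y) (eval_point (Hom A s x y) (Hom A (Neg * s) x y)) (\<phi> y s)"
  shows "v_comp (VHom (vcat_of A) y z \<otimes>\<^sub>V VHom (vcat_of A) c y) (\<phi> z) (VComp (vcat_of A) c y z) =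
      v_comp (VHom (vcat_of A) y z \<otimes>\<^sub>V VHom (vcat_of A) c y)
        (hom_r_mor dual_unit (VHom (vcat_of A) y z \<otimes>\<^sub>V VHom (vcat_of A) x y) (VComp (vcat_of A) x y z))
        (v_comp (VHom (vcat_of A) y z \<otimes>\<^sub>V VHom (vcat_of A) c y)
          (tensor_hom_r (VHom (vcat_of A) y z) dual_unit (VHom (vcat_of A) x y))
          (tensor_mor (VHom (vcat_of A) y z) (VHom (vcat_of A) c y) (v_id (VHom (vcat_of A) y z)) (\<phi> y))) \<longleftrightarrow>
    (\<forall>r t. (\<forall>g\<in>Obj (Hom A r y z). \<forall>f\<in>Obj (Hom A t c y).
        ObjMap (\<psi> z (r * t)) (ObjMap (CComp A r t c y z) (g, f)) =
        ObjMap (CComp A r (Neg * t) x y z) (g, ObjMap (\<psi> y t) f)) \<and>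
      (\<forall>\<beta>\<in>Arr (Hom A r y z). \<forall>\<alpha>\<in>Arr (Hom A t c y).
        ArrMap (\<psi> z (r * t)) (ArrMap (CComp A r t c y z) (\<beta>, \<alpha>)) =
        ArrMap (CComp A r (Neg * t) x y z) (\<beta>, ArrMap (\<psi> y t) \<alpha>)))" (is "?nat \<longleftrightarrow> ?elt")
proof -
  let ?H = "\<lambda>x y s. Hom A s x y"
  let ?P = "?H y z \<otimes>\<^sub>V ?H c y" and ?Q = "?H y z \<otimes>\<^sub>V ?H x y"
  let ?R = "?H y z \<otimes>\<^sub>V hom_r dual_unit (?H x y)"
  let ?E = "\<lambda>s. eval_point (Hom A s x y) (Hom A (Neg * s) x y)"
  let ?T = "tensor_hom_r (?H y z) dual_unit (?H x y)"
  let ?M = "hom_r_mor dual_unit ?Q (vcat_comp A x y z)"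
  let ?F = "tensor_mor (?H y z) (?H c y) (v_id (?H y z)) (\<phi> y)"
  have cat: "category (Hom A s x y)" if "x \<in> Ob A" "y \<in> Ob A" for s x y
    using hom_category that by blast
  have v: "v_obj (?H x y)" if "x \<in> Ob A" "y \<in> Ob A" for x y
    using cat that by (simp add: v_obj_def)
  have vQ: "v_obj ?Q" by (intro category_tensor v X)
  then have catQ: "category (?Q s)" for s by (simp only: v_obj_def)
  have compQ: "v_mor ?Q (?H x z) (vcat_comp A x y z)"
    using v_category.v_comp_mor[OF v_category_vcat_of, of x y z] X by (simp add: vcat_of_def)
  have \<psi>_in: "ObjMap (\<psi> y s) f \<in> Obj (Hom A (Neg * s) x y)" if "y \<in> Ob A" "f \<in> Obj (Hom A s c y)" for y s f
    unfolding \<psi>[OF that(1)]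
    by (intro functor_laws(1)[OF functor_comp[OF \<phi>[OF that(1)] functor_eval_point]] cat X that)
  have \<psi>_in_arr: "ArrMap (\<psi> y s) f \<in> Arr (Hom A (Neg * s) x y)" if "y \<in> Ob A" "f \<in> Arr (Hom A s c y)" for y s f
    unfolding \<psi>[OF that(1)]
    by (intro functor_laws(2)[OF functor_comp[OF \<phi>[OF that(1)] functor_eval_point]] cat X that)
  \<comment> \<open>On an argument of the form \<open>const_point q\<close> the evaluation inside
    \<open>?M\<close> cancels, leaving composition applied to q.\<close>
  have M: "ObjMap (?M s) (ObjMap (const_point (?Q (Neg * s))) q) =
      ObjMap (const_point (Hom A (Neg * s) x z)) (ObjMap (vcat_comp A x y z (Neg * s)) q)"
    if "q \<in> Obj (?Q (Neg * s))" for q s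
    using functor_laws(1)[OF functor_const_point[OF catQ[of s] catQ[of "Neg * s"]] that]
    by (simp add: hom_r_mor_dual_unit[OF vQ compQ] hom_r_dual_unit fun_comp_apply
        eval_const_point_apply[OF catQ catQ] that del: tensor.simps hom_r.simps)
  have M_arr: "ArrMap (?M s) (ArrMap (const_point (?Q (Neg * s))) q) =
      ArrMap (const_point (Hom A (Neg * s) x z)) (ArrMap (vcat_comp A x y z (Neg * s)) q)"
    if "q \<in> Arr (?Q (Neg * s))" for q s
    using functor_laws(2)[OF functor_const_point[OF catQ[of s] catQ[of "Neg * s"]] that]
    by (simp add: hom_r_mor_dual_unit[OF vQ compQ] hom_r_dual_unit fun_comp_apply
        eval_const_point_apply[OF catQ catQ] that del: tensor.simps hom_r.simps)
  have rhs: "ObjMap (?M s) (ObjMap (?T s) (ObjMap (?F s) (sum_in r (g, f)))) =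
      ObjMap (const_point (Hom A (Neg * s) x z))
        (ObjMap (CComp A r (Neg * (r * s)) x y z) (g, ObjMap (\<psi> y (r * s)) f))"
    if "g \<in> Obj (Hom A r y z)" "f \<in> Obj (Hom A (r * s) c y)" for r s g f
  proof -
    have \<phi>f: "ObjMap (\<phi> y (r * s)) f \<in> Obj (hom_r dual_unit (?H x y) (r * s))"
      unfolding hom_r_dual_unit by (intro functor_laws(1)[OF \<phi>] X that)
    have "ObjMap (?F s) (sum_in r (g, f)) = sum_in r (g, ObjMap (\<phi> y (r * s)) f)"
      using that by (simp add: tensor_mor_sum_in v_id_def id_fun_def mk_fun_apply del: tensor_mor.simps)
    \<comment> \<open>\<open>?T\<close> evaluates the second entry, turning the image of f under
      \<phi> into its image under \<psi>, and wraps the whole pair as a point.\<close>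
    moreover have "ObjMap (?T s) \<dots> = ObjMap (const_point (?Q (Neg * s)))
        (sum_in r (g, ObjMap (\<psi> y (r * s)) f))"
      using that \<phi>f
      by (simp add: tensor_hom_r_dual_unit v X fun_comp_apply sum_in_tensor_iff tensor_mor_sum_in
          v_id_def id_fun_def mk_fun_apply \<psi> del: tensor_mor.simps hom_r.simps tensor.simps)
    moreover have "sum_in r (g, ObjMap (\<psi> y (r * s)) f) \<in> Obj (?Q (Neg * s))"
      using that \<psi>_in X by (simp add: sum_in_tensor_iff sign_cancel del: tensor.simps)
    ultimately show ?thesis
      using that \<psi>_in X by (simp add: M vcat_comp_sum_in sign_cancel del: tensor.simps vcat_comp.simps)
  qed
  have rhs_arr: "ArrMap (?M s) (ArrMap (?T s) (ArrMap (?F s) (sum_in r (g, f)))) =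
      ArrMap (const_point (Hom A (Neg * s) x z))
        (ArrMap (CComp A r (Neg * (r * s)) x y z) (g, ArrMap (\<psi> y (r * s)) f))"
    if "g \<in> Arr (Hom A r y z)" "f \<in> Arr (Hom A (r * s) c y)" for r s g f
  proof -
    have \<phi>f: "ArrMap (\<phi> y (r * s)) f \<in> Arr (hom_r dual_unit (?H x y) (r * s))"
      unfolding hom_r_dual_unit by (intro functor_laws(2)[OF \<phi>] X that)
    have "ArrMap (?F s) (sum_in r (g, f)) = sum_in r (g, ArrMap (\<phi> y (r * s)) f)"
      using that by (simp add: tensor_mor_sum_in v_id_def id_fun_def mk_fun_apply del: tensor_mor.simps)
    moreover have "ArrMap (?T s) \<dots> = ArrMap (const_point (?Q (Neg * s)))
        (sum_in r (g, ArrMap (\<psi> y (r * s)) f))"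
      using that \<phi>f
      by (simp add: tensor_hom_r_dual_unit v X fun_comp_apply sum_in_tensor_iff tensor_mor_sum_in
          v_id_def id_fun_def mk_fun_apply \<psi> del: tensor_mor.simps hom_r.simps tensor.simps)
    moreover have "sum_in r (g, ArrMap (\<psi> y (r * s)) f) \<in> Arr (?Q (Neg * s))"
      using that \<psi>_in_arr X by (simp add: sum_in_tensor_iff sign_cancel del: tensor.simps)
    ultimately show ?thesis
      using that \<psi>_in_arr X by (simp add: M_arr vcat_comp_sum_in sign_cancel del: tensor.simps vcat_comp.simps)
  qed
  have obj: "ObjMap (\<phi> z s) (ObjMap (vcat_comp A c y z s) (sum_in r (g, f))) =
      ObjMap (?M s) (ObjMap (?T s) (ObjMap (?F s) (sum_in r (g, f)))) \<longleftrightarrow>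
      ObjMap (\<psi> z s) (ObjMap (CComp A r (r * s) c y z) (g, f)) =
      ObjMap (CComp A r (Neg * (r * s)) x y z) (g, ObjMap (\<psi> y (r * s)) f)" (is "?l = _ \<longleftrightarrow> _ = ?r")
    if gf: "g \<in> Obj (Hom A r y z)" "f \<in> Obj (Hom A (r * s) c y)" for r s g f
  proof -
    have gf_in: "ObjMap (CComp A r (r * s) c y z) (g, f) \<in> Obj (Hom A s c z)"
      using comp_carrier(1)[OF X(2-4) gf] by (simp add: sign_cancel)
    then have l: "?l = ObjMap (const_point (Hom A (Neg * s) x z))
        (ObjMap (\<psi> z s) (ObjMap (CComp A r (r * s) c y z) (g, f)))"
      using gf functor_laws(1)[OF \<phi>[OF X(4)] gf_in]
      by (simp add: vcat_comp_sum_in \<psi> X fun_comp_apply const_eval_point_apply cat del: vcat_comp.simps)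
    have "?r \<in> Obj (Hom A (Neg * s) x z)"
      using comp_carrier(1)[OF X(1,3,4) gf(1) \<psi>_in[OF X(3) gf(2)]] by (simp add: sign_cancel)
    then show ?thesis
      \<comment> \<open>Applying \<open>eval_point\<close> to both sides shows that
        \<open>const_point\<close> is injective.\<close>
      unfolding l rhs[OF gf]
      using \<psi>_in[OF X(4) gf_in] eval_const_point_apply(1)[OF cat cat, OF X(1,4) X(1,4)] by metis
  qed
  have arr: "ArrMap (\<phi> z s) (ArrMap (vcat_comp A c y z s) (sum_in r (g, f))) =
      ArrMap (?M s) (ArrMap (?T s) (ArrMap (?F s) (sum_in r (g, f)))) \<longleftrightarrow>
      ArrMap (\<psi> z s) (ArrMap (CComp A r (r * s) c y z) (g, f)) =
      ArrMap (CComp A r (Neg * (r * s)) x y z) (g, ArrMap (\<psi> y (r * s)) f)" (is "?l = _ \<longleftrightarrow> _ = ?r")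
    if gf: "g \<in> Arr (Hom A r y z)" "f \<in> Arr (Hom A (r * s) c y)" for r s g f
  proof -
    have gf_in: "ArrMap (CComp A r (r * s) c y z) (g, f) \<in> Arr (Hom A s c z)"
      using comp_carrier(2)[OF X(2-4) gf] by (simp add: sign_cancel)
    then have l: "?l = ArrMap (const_point (Hom A (Neg * s) x z))
        (ArrMap (\<psi> z s) (ArrMap (CComp A r (r * s) c y z) (g, f)))"
      using gf functor_laws(2)[OF \<phi>[OF X(4)] gf_in]
      by (simp add: vcat_comp_sum_in \<psi> X fun_comp_apply const_eval_point_apply cat del: vcat_comp.simps)
    have "?r \<in> Arr (Hom A (Neg * s) x z)"
      using comp_carrier(2)[OF X(1,3,4) gf(1) \<psi>_in_arr[OF X(3) gf(2)]] by (simp add: sign_cancel)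
    then show ?thesis
      unfolding l rhs_arr[OF gf]
      using \<psi>_in_arr[OF X(4) gf_in] eval_const_point_apply(2)[OF cat cat, OF X(1,4) X(1,4)] by metis
  qed
  have "?nat \<longleftrightarrow> (\<forall>s.
      (\<forall>a\<in>Obj (?P s). ObjMap (\<phi> z s) (ObjMap (vcat_comp A c y z s) a) =
        ObjMap (?M s) (ObjMap (?T s) (ObjMap (?F s) a))) \<and>
      (\<forall>a\<in>Arr (?P s). ArrMap (\<phi> z s) (ArrMap (vcat_comp A c y z s) a) =
        ArrMap (?M s) (ArrMap (?T s) (ArrMap (?F s) a))))"
    by (simp add: vcat_of_def fun_eq_iff v_comp_def fun_comp_def mk_fun_eq_iff mk_fun_apply
        del: tensor.simps vcat_comp.simps tensor_mor.simps)
  also have "\<dots> \<longleftrightarrow> (\<forall>s r. (\<forall>g\<in>Obj (Hom A r y z). \<forall>f\<in>Obj (Hom A (r * s) c y).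
        ObjMap (\<psi> z s) (ObjMap (CComp A r (r * s) c y z) (g, f)) =
        ObjMap (CComp A r (Neg * (r * s)) x y z) (g, ObjMap (\<psi> y (r * s)) f)) \<and>
      (\<forall>\<beta>\<in>Arr (Hom A r y z). \<forall>\<alpha>\<in>Arr (Hom A (r * s) c y).
        ArrMap (\<psi> z s) (ArrMap (CComp A r (r * s) c y z) (\<beta>, \<alpha>)) =
        ArrMap (CComp A r (Neg * (r * s)) x y z) (\<beta>, ArrMap (\<psi> y (r * s)) \<alpha>)))"
    unfolding ball_tensor all_conj_distrib
    by (intro all_cong1 arg_cong2[where f = "(\<and>)"] ball_cong refl obj arr)
  \<comment> \<open>The parameter changes from the sign s of the composite to the sign t of
    f.\<close>
  also have "\<dots> \<longleftrightarrow> ?elt"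
    by (rule sign_reindex)
  finally show ?thesis .
qed

text \<open>The component in each sign is precomposition with \<chi> followed by
  \<open>const_point\<close>, a composite of two isomorphisms; its naturality is associativity of
  composition.\<close>

lemma copower_of_strict_opposite:
  assumes x: "x \<in> Ob A" and opp: "strict_opposite A x c \<chi>"
  shows "is_copower (vcat_of A) dual_unit x c
    (\<lambda>y s. fun_comp (Hom A s c y) (const_point (Hom A (Neg * s) x y)) (precomp_fun A Neg x c \<chi> s y))"
    (is "is_copower _ _ _ _ ?\<phi>")
proof -
  have c: "c \<in> Ob A" and \<chi>: "\<chi> \<in> Obj (Hom A Neg x c)"
    using opp by (auto simp: strict_opposite_def)
  have pre: "cat_iso (Hom A s c y) (Hom A (Neg * s) x y) (precomp_fun A Neg x c \<chi> s y)" if "y \<in> Ob A" for s y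
    using opp that by (cases s) (auto simp: strict_opposite_def)
  have iso: "cat_iso (Hom A s c y) (dual_hom (Hom A s x y) (Hom A (Neg * s) x y)) (?\<phi> y s)"
    if "y \<in> Ob A" for s y
    using that by (intro cat_iso_comp[OF pre] iso_const_point hom_category x)
  have \<psi>: "precomp_fun A Neg x c \<chi> s y =
      fun_comp (Hom A s c y) (eval_point (Hom A s x y) (Hom A (Neg * s) x y)) (?\<phi> y s)"
    if "y \<in> Ob A" for s y
    using cat_iso_functor[OF pre[OF that, of s]] that
    by (simp add: fun_comp_assoc eval_const_point hom_category x fun_comp_id_left)
  have id\<chi>: "Id (Hom A Neg x c) \<chi> \<in> Arr (Hom A Neg x c)"
    by (intro category.id_arr hom_category x c \<chi>)
  have nat: "(\<forall>g\<in>Obj (Hom A r y z). \<forall>f\<in>Obj (Hom A t c y).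
        ObjMap (precomp_fun A Neg x c \<chi> (r * t) z) (ObjMap (CComp A r t c y z) (g, f)) =
        ObjMap (CComp A r (Neg * t) x y z) (g, ObjMap (precomp_fun A Neg x c \<chi> t y) f)) \<and>
      (\<forall>\<beta>\<in>Arr (Hom A r y z). \<forall>\<alpha>\<in>Arr (Hom A t c y).
        ArrMap (precomp_fun A Neg x c \<chi> (r * t) z) (ArrMap (CComp A r t c y z) (\<beta>, \<alpha>)) =
        ArrMap (CComp A r (Neg * t) x y z) (\<beta>, ArrMap (precomp_fun A Neg x c \<chi> t y) \<alpha>))"
    if yz: "y \<in> Ob A" "z \<in> Ob A" for r t y z
    \<comment> \<open>Associativity is used with \<chi>, or its identity 2-cell, as the rightmost
      factor. Precomposition yields sign \<open>t * Neg\<close>, hence the appeal to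
      commutativity.\<close>
    using assoc_obj[OF x c yz, of _ r _ t, OF _ _ \<chi>] assoc_arr[OF x c yz, of _ r _ t, OF _ _ id\<chi>]
    by (simp add: precomp_fun_def mk_fun_apply comp_carrier[OF c yz] mult.commute[of t Neg])
  show ?thesis
    unfolding is_copower_def
  proof (intro conjI ballI)
    show "c \<in> VOb (vcat_of A)" using c by (simp add: vcat_of_def)
    fix y assume "y \<in> VOb (vcat_of A)"
    then show "v_iso (VHom (vcat_of A) c y) (hom_r dual_unit (VHom (vcat_of A) x y)) (?\<phi> y)"
      using iso by (simp add: v_iso_iff hom_r_dual_unit vcat_of_def del: hom_r.simps)
  next
    fix y z assume "y \<in> VOb (vcat_of A)" "z \<in> VOb (vcat_of A)"
    then have yz: "y \<in> Ob A" "z \<in> Ob A" by (simp_all add: vcat_of_def)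
    show "v_comp (VHom (vcat_of A) y z \<otimes>\<^sub>V VHom (vcat_of A) c y) (?\<phi> z) (VComp (vcat_of A) c y z) =
      v_comp (VHom (vcat_of A) y z \<otimes>\<^sub>V VHom (vcat_of A) c y)
        (hom_r_mor dual_unit (VHom (vcat_of A) y z \<otimes>\<^sub>V VHom (vcat_of A) x y) (VComp (vcat_of A) x y z))
        (v_comp (VHom (vcat_of A) y z \<otimes>\<^sub>V VHom (vcat_of A) c y)
          (tensor_hom_r (VHom (vcat_of A) y z) dual_unit (VHom (vcat_of A) x y))
          (tensor_mor (VHom (vcat_of A) y z) (VHom (vcat_of A) c y) (v_id (VHom (vcat_of A) y z)) (?\<phi> y)))"
      by (rule copower_naturality_iff[where \<phi> = ?\<phi> and \<psi> = "\<lambda>y s. precomp_fun A Neg x c \<chi> s y",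
            OF x c yz cat_iso_functor[OF iso] \<psi>, THEN iffD2])
        (assumption | intro allI nat yz)+
  qed
qed

text \<open>The Yoneda argument: naturality at the unit of c gives \<psi> g = \<psi> (g . 1) = g .
  \<psi> 1, so precomposition with \<psi> 1 is the isomorphism \<psi>.\<close>

lemma strict_opposite_of_copower:
  assumes x: "x \<in> Ob A" and cop: "is_copower (vcat_of A) dual_unit x c \<phi>"
  shows "\<exists>\<chi>. strict_opposite A x c \<chi>"
proof -
  have c: "c \<in> Ob A" using cop by (simp add: is_copower_def vcat_of_def)
  have iso: "cat_iso (Hom A s c y) (dual_hom (Hom A s x y) (Hom A (Neg * s) x y)) (\<phi> y s)"
    if "y \<in> Ob A" for s y
    using cop that
    by (simp add: is_copower_def v_iso_iff hom_r_dual_unit vcat_of_def del: hom_r.simps)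
  define \<psi> where "\<psi> y s =
    fun_comp (Hom A s c y) (eval_point (Hom A s x y) (Hom A (Neg * s) x y)) (\<phi> y s)" for y s
  have iso_\<psi>: "cat_iso (Hom A s c y) (Hom A (Neg * s) x y) (\<psi> y s)" if "y \<in> Ob A" for s y
    unfolding \<psi>_def using that by (intro cat_iso_comp[OF iso] iso_eval_point hom_category x)
  have nat: "(\<forall>g\<in>Obj (Hom A r y z). \<forall>f\<in>Obj (Hom A t c y).
        ObjMap (\<psi> z (r * t)) (ObjMap (CComp A r t c y z) (g, f)) =
        ObjMap (CComp A r (Neg * t) x y z) (g, ObjMap (\<psi> y t) f)) \<and>
      (\<forall>\<beta>\<in>Arr (Hom A r y z). \<forall>\<alpha>\<in>Arr (Hom A t c y).
        ArrMap (\<psi> z (r * t)) (ArrMap (CComp A r t c y z) (\<beta>, \<alpha>)) =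
        ArrMap (CComp A r (Neg * t) x y z) (\<beta>, ArrMap (\<psi> y t) \<alpha>))"
    if "y \<in> Ob A" "z \<in> Ob A" for r t y z
    using copower_naturality_iff[OF x c that cat_iso_functor[OF iso], of \<psi>] cop that
    by (simp add: \<psi>_def is_copower_def vcat_of_def)
  have one: "CUnit A c \<in> Obj (Hom A Pos c c)" and id_one: "Id (Hom A Pos c c) (CUnit A c) \<in> Arr (Hom A Pos c c)"
    using c by (auto intro: unit_obj category.id_arr hom_category)
  note \<psi>_one = functor_laws[OF cat_iso_functor[OF iso_\<psi>[OF c, of Pos]]]
  \<comment> \<open>The universal element: the image of the unit 1-cell of c, which has sign
    \<open>Neg\<close> because \<psi> reverses signs.\<close>
  let ?\<chi> = "ObjMap (\<psi> c Pos) (CUnit A c)"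
  have Pos_right: "s * Pos = s" for s by (cases s) simp_all
  have precomp: "precomp_fun A Neg x c ?\<chi> s y = \<psi> y s" if y: "y \<in> Ob A" for s y
  proof -
    have "ObjMap (CComp A s Neg x c y) (g, ?\<chi>) = ObjMap (\<psi> y s) g" if g: "g \<in> Obj (Hom A s c y)" for g
    proof -
      have "ObjMap (\<psi> y (s * Pos)) (ObjMap (CComp A s Pos c c y) (g, CUnit A c)) =
          ObjMap (CComp A s (Neg * Pos) x c y) (g, ?\<chi>)"
        using nat[OF c y] g one by blast
      then show ?thesis
        using g c y by (simp add: Pos_right unit_right_obj)
    qed
    moreover have "ArrMap (CComp A s Neg x c y) (\<beta>, Id (Hom A Neg x c) ?\<chi>) = ArrMap (\<psi> y s) \<beta>"
      if \<beta>: "\<beta> \<in> Arr (Hom A s c y)" for \<beta>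
    proof -
      have "ArrMap (\<psi> y (s * Pos)) (ArrMap (CComp A s Pos c c y) (\<beta>, Id (Hom A Pos c c) (CUnit A c))) =
          ArrMap (CComp A s (Neg * Pos) x c y) (\<beta>, ArrMap (\<psi> c Pos) (Id (Hom A Pos c c) (CUnit A c)))"
        using nat[OF c y] \<beta> id_one by blast
      \<comment> \<open>The functor \<psi> preserves identities, so the identity 2-cell of the unit
        goes to that of \<open>?\<chi>\<close>.\<close>
      then show ?thesis
        using \<beta> c y \<psi>_one(5)[OF one] by (simp add: Pos_right unit_right_arr)
    qed
    ultimately show ?thesis
      by (subst functor_eq_mk_fun[OF cat_iso_functor[OF iso_\<psi>[OF y]]])
        (simp add: precomp_fun_def mk_fun_eq_iff)
  qed
  show ?thesis
    unfolding strict_opposite_def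
    using c \<psi>_one(1)[OF one] iso_\<psi>[of _ Pos] iso_\<psi>[of _ Neg] by (intro exI[of _ ?\<chi>]) (simp add: precomp)
qed

end

theorem theorem6p4:
  fixes A :: "('x, 'o, 'm) contra_2cat"
  assumes "contravariance_2category A"
  shows "(\<forall>x\<in>Ob A. \<exists>x' \<chi>. strict_opposite A x x' \<chi>) \<longleftrightarrow>
    has_copowers_by (vcat_of A) dual_unit"
proof -
  interpret contravariance_2category A by fact
  have Ob: "VOb (vcat_of A) = Ob A" by (simp add: vcat_of_def)
  show ?thesis
    unfolding has_copowers_by_def Ob
    \<comment> \<open>The equivalence holds separately for each x, and the same object serves as
      strict opposite and as copower.\<close>
    by (intro ball_cong refl iffI) (blast dest: copower_of_strict_opposite strict_opposite_of_copower)+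
qed

end
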